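(* Let $G$ be an swm-graph and $p,q$ vertices of $G$, with $k=d_{G^{\Delta}}(p,q)$. There is a unique normal Boolean-gated path $\gamma_{pq}=(p=x_0,x_1,\ldots,x_k=q)$ from $p$ to $q$, and its vertices are given recursively by $x_k=q$ and, for $i=k-1,k-2,\ldots,0$, $x_i$ is the $\Delta$--gate of $p$ at $x_{i+1}$. In particular, any normal Boolean-gated path is a shortest path of $G^{\Delta}$.
   Context: Graphs are simple, undirected, connected, possibly infinite; $d$ is distance in $G$, $I(u,v)=\{x:d(u,x)+d(x,v)=d(u,v)\}$. Weakly modular: for every vertex $u$, (TC) for $v,w$ with $1=d(v,w)<d(u,v)=d(u,w)$ there is a common neighbor $x$ of $v,w$ with $d(u,x)=d(u,v)-1$, and (QC) for $v,w,z$ with $d(v,z)=d(w,z)=1$, $2=d(v,w)\le d(u,v)=d(u,w)=d(u,z)-1$ there is a common neighbor $x$ of $v,w$ with $d(u,x)=d(u,v)-1$. An swm-graph is a weakly modular graph without induced $K_4^-$ and isometric $K_{3,3}^-$. A set $X$ is gated if each vertex $x$ has a (unique) gate $x'\in X$ with $x'\in I(x,y)$ for all $y\in X$; $\langle x,y\rangle$ denotes the smallest gated set containing $x,y$. A Boolean-gated set is a gated set inducing a thick subgraph (every $I(u,v)$ with $d(u,v)=2$ contains an induced $4$--cycle). A pair $(x,y)$ is Boolean if the subgraph induced by $I(x,y)$ contains an isometric $d(x,y)$--cube. $G^{\Delta}$ is the graph on $V(G)$ whose edges are the pairs that are adjacent in $G$ or are Boolean pairs at distance $\ge2$; $d_{G^{\Delta}}$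 is its distance. For vertices $a,b$ with $a\neq b$, the $\Delta$--gate of $a$ at $b$ is the gate of $b$ in the vertex set $\{z: d_{G^{\Delta}}(a,z)\le d_{G^{\Delta}}(a,b)-1\}$ (a ball of $G^{\Delta}$, which is a gated subset of $G$). A path $(x_0,\ldots,x_k)$ of $G^{\Delta}$ is a normal Boolean-gated path if for every $i=1,\ldots,k-1$ and every Boolean-gated set $B$ containing $\langle x_{i-1},x_i\rangle$ one has $B\cap\langle x_i,x_{i+1}\rangle=\{x_i\}$. *)

theory Defs
  imports Main
begin

definition simple_graph :: "('a \<Rightarrow> 'a \<Rightarrow> bool) \<Rightarrow> bool" where
  "simple_graph E \<longleftrightarrow> (\<forall>u. \<not> E u u) \<and> (\<forall>u v. E u v \<longrightarrow> E v u)"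

definition walk_in :: "('a \<Rightarrow> 'a \<Rightarrow> bool) \<Rightarrow> 'a set \<Rightarrow> 'a list \<Rightarrow> bool" where
  "walk_in E S xs \<longleftrightarrow> xs \<noteq> [] \<and> set xs \<subseteq> S \<and>
     (\<forall>i. Suc i < length xs \<longrightarrow> E (xs ! i) (xs ! Suc i))"

definition connected_graph :: "('a \<Rightarrow> 'a \<Rightarrow> bool) \<Rightarrow> bool" where
  "connected_graph E \<longleftrightarrow>
     (\<forall>u v. \<exists>xs. walk_in E UNIV xs \<and> hd xs = u \<and> last xs = v)"

definition dist_in :: "('a \<Rightarrow> 'a \<Rightarrow> bool) \<Rightarrow> 'a set \<Rightarrow> 'a \<Rightarrow> 'a \<Rightarrow> nat" where
  "dist_in E S u v = (LEAST n. \<exists>xs. walk_in E S xs \<and> hd xs = u \<and> last xs = v \<and> length xs = Suc n)"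

abbreviation gdist :: "('a \<Rightarrow> 'a \<Rightarrow> bool) \<Rightarrow> 'a \<Rightarrow> 'a \<Rightarrow> nat" where
  "gdist E \<equiv> dist_in E UNIV"

definition interval :: "('a \<Rightarrow> 'a \<Rightarrow> bool) \<Rightarrow> 'a \<Rightarrow> 'a \<Rightarrow> 'a set" where
  "interval E u v = {x. gdist E u x + gdist E x v = gdist E u v}"

definition weakly_modular :: "('a \<Rightarrow> 'a \<Rightarrow> bool) \<Rightarrow> bool" where
  "weakly_modular E \<longleftrightarrow>
     (\<forall>u v w. gdist E v w = 1 \<and> 1 < gdist E u v \<and> gdist E u v = gdist E u w \<longrightarrow>
        (\<exists>x. E x v \<and> E x w \<and> gdist E u x = gdist E u v - 1)) \<and>
     (\<forall>u v w z. gdist E v z = 1 \<and> gdist E w z = 1 \<and> gdist E v w = 2 \<and> 2 \<le> gdist E u v \<and>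
        gdist E u v = gdist E u w \<and> gdist E u z = gdist E u v + 1 \<longrightarrow>
        (\<exists>x. E x v \<and> E x w \<and> gdist E u x = gdist E u v - 1))"

definition has_induced_K4_minus :: "('a \<Rightarrow> 'a \<Rightarrow> bool) \<Rightarrow> bool" where
  "has_induced_K4_minus E \<longleftrightarrow> (\<exists>a b c d. distinct [a, b, c, d] \<and>
     E a b \<and> E a c \<and> E a d \<and> E b c \<and> E b d \<and> \<not> E c d)"

definition has_isometric_K33_minus :: "('a \<Rightarrow> 'a \<Rightarrow> bool) \<Rightarrow> bool" where
  "has_isometric_K33_minus E \<longleftrightarrow> (\<exists>a b :: nat \<Rightarrow> 'a.
     (\<forall>i\<in>{1,2,3}. \<forall>j\<in>{1,2,3}. gdist E (a i) (b j) = (if i = 1 \<and> j = 1 then 3 else 1)) \<and>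
     (\<forall>i\<in>{1,2,3}. \<forall>j\<in>{1,2,3}. i \<noteq> j \<longrightarrow> gdist E (a i) (a j) = 2 \<and> gdist E (b i) (b j) = 2))"

definition swm_graph :: "('a \<Rightarrow> 'a \<Rightarrow> bool) \<Rightarrow> bool" where
  "swm_graph E \<longleftrightarrow> simple_graph E \<and> connected_graph E \<and> weakly_modular E \<and>
     \<not> has_induced_K4_minus E \<and> \<not> has_isometric_K33_minus E"

definition is_gate :: "('a \<Rightarrow> 'a \<Rightarrow> bool) \<Rightarrow> 'a set \<Rightarrow> 'a \<Rightarrow> 'a \<Rightarrow> bool" where
  "is_gate E X x g \<longleftrightarrow> g \<in> X \<and> (\<forall>y\<in>X. g \<in> interval E x y)"

definition gated :: "('a \<Rightarrow> 'a \<Rightarrow> bool) \<Rightarrow> 'a set \<Rightarrow> bool" where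
  "gated E X \<longleftrightarrow> (\<forall>x. \<exists>g. is_gate E X x g)"

definition gate :: "('a \<Rightarrow> 'a \<Rightarrow> bool) \<Rightarrow> 'a set \<Rightarrow> 'a \<Rightarrow> 'a" where
  "gate E X x = (THE g. is_gate E X x g)"

definition gated_hull2 :: "('a \<Rightarrow> 'a \<Rightarrow> bool) \<Rightarrow> 'a \<Rightarrow> 'a \<Rightarrow> 'a set" where
  "gated_hull2 E x y = \<Inter>{X. gated E X \<and> x \<in> X \<and> y \<in> X}"

definition induced_C4 :: "('a \<Rightarrow> 'a \<Rightarrow> bool) \<Rightarrow> 'a \<Rightarrow> 'a \<Rightarrow> 'a \<Rightarrow> 'a \<Rightarrow> bool" where
  "induced_C4 E a b c d \<longleftrightarrow> distinct [a, b, c, d] \<and>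
     E a b \<and> E b c \<and> E c d \<and> E d a \<and> \<not> E a c \<and> \<not> E b d"

text \<open>The subgraph induced by X is thick (X gated, hence convex, so intervals/distances are those of G).\<close>
definition thick_set :: "('a \<Rightarrow> 'a \<Rightarrow> bool) \<Rightarrow> 'a set \<Rightarrow> bool" where
  "thick_set E X \<longleftrightarrow> (\<forall>u\<in>X. \<forall>v\<in>X. dist_in E X u v = 2 \<longrightarrow>
     (\<exists>a b c d. {a, b, c, d} \<subseteq> {x \<in> X. dist_in E X u x + dist_in E X x v = dist_in E X u v}
        \<and> induced_C4 E a b c d))"

definition boolean_gated :: "('a \<Rightarrow> 'a \<Rightarrow> bool) \<Rightarrow> 'a set \<Rightarrow> bool" where
  "boolean_gated E B \<longleftrightarrow> gated E B \<and> thick_set E B"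

text \<open>Boolean pair: the subgraph induced by I(x,y) contains an isometric d(x,y)-cube.
  The n-cube has vertex set the subsets of {..<n} with Hamming distance.\<close>
definition boolean_pair :: "('a \<Rightarrow> 'a \<Rightarrow> bool) \<Rightarrow> 'a \<Rightarrow> 'a \<Rightarrow> bool" where
  "boolean_pair E x y \<longleftrightarrow> (\<exists>f :: nat set \<Rightarrow> 'a.
     (\<forall>A. A \<subseteq> {..<gdist E x y} \<longrightarrow> f A \<in> interval E x y) \<and>
     (\<forall>A B. A \<subseteq> {..<gdist E x y} \<longrightarrow> B \<subseteq> {..<gdist E x y} \<longrightarrow>
        dist_in E (interval E x y) (f A) (f B) = card ((A - B) \<union> (B - A))))"

definition delta_edge :: "('a \<Rightarrow> 'a \<Rightarrow> bool) \<Rightarrow> 'a \<Rightarrow> 'a \<Rightarrow> bool" where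
  "delta_edge E u v \<longleftrightarrow> E u v \<or> (2 \<le> gdist E u v \<and> boolean_pair E u v)"

abbreviation delta_dist :: "('a \<Rightarrow> 'a \<Rightarrow> bool) \<Rightarrow> 'a \<Rightarrow> 'a \<Rightarrow> nat" where
  "delta_dist E \<equiv> gdist (delta_edge E)"

definition delta_gate :: "('a \<Rightarrow> 'a \<Rightarrow> bool) \<Rightarrow> 'a \<Rightarrow> 'a \<Rightarrow> 'a" where
  "delta_gate E a b = gate E {z. delta_dist E a z \<le> delta_dist E a b - 1} b"

definition normal_bg_path :: "('a \<Rightarrow> 'a \<Rightarrow> bool) \<Rightarrow> 'a list \<Rightarrow> bool" where
  "normal_bg_path E xs \<longleftrightarrow> walk_in (delta_edge E) UNIV xs \<and>
     (\<forall>i. 1 \<le> i \<and> Suc i < length xs \<longrightarrow>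
        (\<forall>B. boolean_gated E B \<and> gated_hull2 E (xs ! (i - 1)) (xs ! i) \<subseteq> B \<longrightarrow>
           B \<inter> gated_hull2 E (xs ! i) (xs ! Suc i) = {xs ! i}))"

end

(* Call a pair (x,y) thick if every I(u,w) with d(u,w) = 2 on a geodesic from x to y has two
   middle vertices. Seen from x, an swm-graph is graded, and two lower neighbours of a vertex have
   a unique common lower neighbour (absence of isometric K_{3,3}^-). With this, the vertices y for
   which (x,y) is thick are closed under passing to a neighbour on the same level and to a common
   upper neighbour of two of them, and so form a gated set. Therefore the gated hull of a thick pair
   consists of pairwise thick pairs, i.e. it is Boolean-gated, and a pair is thick iff it is trivial
   or an edge of G^Delta: a cube is built by translating a smaller cube along gate maps, and
   conversely thickness spreads over a cube by the closure property. If X is gated then so is the set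
   of vertices in thick pairs with vertices of X, hence the balls of G^Delta are gated.

   The normality condition at x_i then says exactly that x_i is the gate of x_{i+1} in the
   ball of radius i around p: no neighbour of x_i in the hull of x_i and x_{i+1} is farther from
   x_{i+1} than x_i, and any neighbour of x_i inside the ball lies with x_{i-1} and x_i in a
   Boolean-gated set. *)
theory Submission
  imports Defs
begin

section \<open>Walks and distances\<close>

text \<open>A hull is hard to describe from inside: it contains whole cliques and can be larger than
  the interval of its generators. So upper bounds on hulls are proved from outside, by choosing a
  predicate \<open>Q\<close> whose extension is gated and contains both generators. Every such
  \<open>Q\<close> is an order ideal of the levels around a base point, and two induction schemes,
  \<open>same_level_induct\<close> and \<open>join_induct\<close>, reduce its closure to the lower
  neighbours of the vertex in question. The local obstacle is to produce a second middle vertex of a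
  square. The base point alone does not give it; the arguments pass to a nearby vertex, at distance
  2 or 3 from the square's far corners, and use the triangle or quadrangle condition from there.
  Meets are unique around every base point, and this, or a distance 3, shows that the vertex found
  is new. All inductions run over distances or levels, so infinite graphs need no separate
  treatment.\<close>

lemma walk_in_Cons_Cons:
  "walk_in E S (x # y # ys) \<longleftrightarrow> x \<in> S \<and> E x y \<and> walk_in E S (y # ys)"
  unfolding walk_in_def
  by (auto simp: less_Suc_eq_0_disj)

lemma walk_in_single: "walk_in E S [x] \<longleftrightarrow> x \<in> S"
  by (auto simp: walk_in_def)

text \<open>Relation powers replace lists, so that inductions peel off one step. Steps test only
  their target for membership in \<open>S\<close>; testing the start separately also covers the walk
  of length 0.\<close>

lemma walk_iff_relpowp:
  "(\<exists>xs. walk_in E S xs \<and> hd xs = u \<and> last xs = v \<and> length xs = Suc n) \<longleftrightarrow>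
     u \<in> S \<and> ((\<lambda>a b. E a b \<and> b \<in> S) ^^ n) u v"
proof (induction n arbitrary: u)
  case 0
  show ?case
    by (auto simp: length_Suc_conv walk_in_single intro!: exI[of _ "[u]"])
next
  case (Suc n)
  have "(\<exists>xs. walk_in E S xs \<and> hd xs = u \<and> last xs = v \<and> length xs = Suc (Suc n)) \<longleftrightarrow>
    (\<exists>y. u \<in> S \<and> E u y \<and> (\<exists>xs. walk_in E S xs \<and> hd xs = y \<and> last xs = v \<and> length xs = Suc n))"
    (is "?L \<longleftrightarrow> ?R")
  proof
    assume ?L
    then obtain xs where xs: "walk_in E S xs" "hd xs = u" "last xs = v" "length xs = Suc (Suc n)"
      by blast
    then obtain y ys where "xs = u # y # ys" by (auto simp: length_Suc_conv)
    with xs show ?R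
      by (intro exI[of _ y] conjI exI[of _ "y # ys"]) (auto simp: walk_in_Cons_Cons)
  next
    assume ?R
    then obtain y xs where y: "u \<in> S" "E u y" "walk_in E S xs" "hd xs = y" "last xs = v"
      "length xs = Suc n" by blast
    then obtain ys where "xs = y # ys" by (auto simp: length_Suc_conv)
    with y show ?L
      by (intro exI[of _ "u # y # ys"]) (auto simp: walk_in_Cons_Cons)
  qed
  also have "\<dots> \<longleftrightarrow> u \<in> S \<and> ((\<lambda>a b. E a b \<and> b \<in> S) ^^ Suc n) u v"
    unfolding Suc.IH
    by (auto dest: relpowp_Suc_D2 intro: relpowp_Suc_I2 simp del: relpowp.simps)
  finally show ?case .
qed

lemma dist_in_eq_Least:
  "dist_in E S u v = (LEAST n. u \<in> S \<and> ((\<lambda>a b. E a b \<and> b \<in> S) ^^ n) u v)"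
  unfolding dist_in_def walk_iff_relpowp ..

lemma dist_in_le:
  "u \<in> S \<Longrightarrow> ((\<lambda>a b. E a b \<and> b \<in> S) ^^ n) u v \<Longrightarrow> dist_in E S u v \<le> n"
  unfolding dist_in_eq_Least by (rule Least_le) simp

lemma relpowp_dist_in:
  assumes "u \<in> S" "((\<lambda>a b. E a b \<and> b \<in> S) ^^ n) u v"
  shows "((\<lambda>a b. E a b \<and> b \<in> S) ^^ dist_in E S u v) u v"
  using LeastI[of "\<lambda>n. u \<in> S \<and> ((\<lambda>a b. E a b \<and> b \<in> S) ^^ n) u v" n] assms
  unfolding dist_in_eq_Least by blast

locale cgraph =
  fixes E :: "'a \<Rightarrow> 'a \<Rightarrow> bool"
  assumes simple: "simple_graph E" and connected: "connected_graph E"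
begin

abbreviation d :: "'a \<Rightarrow> 'a \<Rightarrow> nat" where "d \<equiv> gdist E"

lemma irrefl [simp]: "\<not> E u u"
  using simple by (auto simp: simple_graph_def)

lemma sym: "E u v \<Longrightarrow> E v u"
  using simple by (auto simp: simple_graph_def)

lemma sym_iff: "E u v \<longleftrightarrow> E v u"
  using sym by blast

lemma d_le: "(E ^^ n) u v \<Longrightarrow> d u v \<le> n"
  using dist_in_le[where S = UNIV] by simp

lemma relpowp_d: "(E ^^ d u v) u v"
proof -
  obtain xs where xs: "walk_in E UNIV xs" "hd xs = u" "last xs = v"
    using connected by (auto simp: connected_graph_def)
  then have "length xs = Suc (length xs - 1)" by (cases xs) (auto simp: walk_in_def)
  then have "u \<in> UNIV \<and> ((\<lambda>a b. E a b \<and> b \<in> UNIV) ^^ (length xs - 1)) u v"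
    using xs walk_iff_relpowp[of E UNIV u v "length xs - 1"] by blast
  then show ?thesis using relpowp_dist_in[where S = UNIV] by simp
qed

lemma d_self [simp]: "d u u = 0"
  using d_le[of 0 u u] by simp

lemma d_0 [simp]: "d u v = 0 \<longleftrightarrow> u = v"
  using relpowp_d[of u v] by auto

lemma d_1: "d u v = 1 \<longleftrightarrow> E u v"
proof
  show "E u v" if "d u v = 1" using relpowp_d[of u v] that by auto
  assume "E u v"
  then have "d u v \<le> 1" using d_le[of 1 u v] by (metis relpowp_1)
  moreover have "u \<noteq> v" using \<open>E u v\<close> by auto
  ultimately show "d u v = 1" using d_0[of u v] by linarith
qed

lemma relpowp_sym: "(E ^^ n) u v \<Longrightarrow> (E ^^ n) v u"
proof (induction n arbitrary: u v)
  case (Suc n)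
  then obtain w where "E u w" "(E ^^ n) w v" using relpowp_Suc_D2[of n E u v] by blast
  then have "(E ^^ n) v w" "E w u" using Suc.IH sym by blast+
  then show ?case by (rule relpowp_Suc_I)
qed simp

lemma d_sym: "d u v = d v u"
  using d_le[OF relpowp_sym[OF relpowp_d]] by (simp add: order_antisym)

lemma d_triangle: "d u w \<le> d u v + d v w"
  using d_le[OF relpowp_trans[OF relpowp_d relpowp_d]] .

lemma d_lip: "E a b \<Longrightarrow> d p a \<le> d p b + 1"
  using d_triangle[of p a b] d_1[of b a] sym[of a b] by linarith

lemma d_lip2: "E a b \<Longrightarrow> d a p \<le> d b p + 1"
  using d_lip d_sym by metis

lemma d_step:
  assumes "d u v = Suc n"
  obtains w where "E u w" "d w v = n"
proof -
  have "(E ^^ Suc n) u v" using relpowp_d[of u v] assms by simp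
  then obtain w where w: "E u w" "(E ^^ n) w v" using relpowp_Suc_D2[of n E u v] by blast
  then have "d w v \<le> n" using d_le by blast
  moreover have "d u v \<le> d w v + 1" using w d_lip2 by blast
  ultimately show ?thesis using w assms that by simp
qed

lemma d_step':
  assumes "d u v = Suc n"
  obtains w where "E w v" "d u w = n"
  using d_step[of v u n] assms by (simp add: d_sym[of v u] d_sym[of _ u]) (metis sym)

lemma d_eq_2I: "E a b \<Longrightarrow> E b c \<Longrightarrow> a \<noteq> c \<Longrightarrow> \<not> E a c \<Longrightarrow> d a c = 2"
proof -
  assume a: "E a b" "E b c" "a \<noteq> c" "\<not> E a c"
  then have "d a c \<le> 2" using d_lip2[of a b c] d_1[of b c] by linarith
  moreover have "d a c \<noteq> 0" "d a c \<noteq> 1" using a d_1 by auto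
  ultimately show ?thesis by linarith
qed

lemma d_2E:
  assumes "d a c = 2" obtains b where "E a b" "E b c"
proof -
  have "d a c = Suc 1" using assms by simp
  then obtain b where "E a b" "d b c = 1" using d_step by blast
  then show ?thesis using that d_1 by blast
qed

lemma mem_interval: "z \<in> interval E x y \<longleftrightarrow> d x z + d z y = d x y"
  by (simp add: interval_def)

text \<open>\<open>dist_in\<close> is a \<open>LEAST\<close> with no specified value when
  \<open>S\<close> contains no walk, so a walk must be supplied before comparing it with
  \<open>d\<close>.\<close>

lemma dist_in_ge:
  assumes "u \<in> S" "((\<lambda>a b. E a b \<and> b \<in> S) ^^ n) u v"
  shows "d u v \<le> dist_in E S u v"
proof -
  have "((\<lambda>a b. E a b \<and> b \<in> S) ^^ m) a b \<Longrightarrow> (E ^^ m) a b" for m a b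
    by (induction m arbitrary: b) auto
  then show ?thesis using relpowp_dist_in[OF assms] d_le by blast
qed

lemma dist_in_convex:
  assumes conv: "\<And>u v w. u \<in> S \<Longrightarrow> v \<in> S \<Longrightarrow> w \<in> interval E u v \<Longrightarrow> w \<in> S"
    and uv: "u \<in> S" "v \<in> S"
  shows "dist_in E S u v = d u v"
proof -
  have *: "((\<lambda>a b. E a b \<and> b \<in> S) ^^ n) u v" if "d u v = n" "u \<in> S" for n u
    using that
  proof (induction n arbitrary: u)
    case (Suc n)
    then obtain w where w: "E u w" "d w v = n" using d_step by metis
    then have "w \<in> interval E u v" using Suc.prems d_1[of u w] by (simp add: mem_interval)
    then have "w \<in> S" using conv Suc.prems uv by blast
    with w Suc.IH show ?case by (intro relpowp_Suc_I2) auto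
  qed auto
  show ?thesis
    using dist_in_le[OF uv(1) *[OF refl uv(1)]] dist_in_ge[OF uv(1) *[OF refl uv(1)]] by simp
qed

end

section \<open>Levels and covers in swm-graphs\<close>

locale swm = 
  fixes E :: "'a \<Rightarrow> 'a \<Rightarrow> bool"
  assumes swm: "swm_graph E"

sublocale swm \<subseteq> cgraph E
  using swm by unfold_locales (auto simp: swm_graph_def)

context swm
begin

text \<open>The covering relation of the grading around \<open>p\<close>. The base point is an
  argument because the proofs compare the gradings around several vertices.\<close>

definition cov :: "'a \<Rightarrow> 'a \<Rightarrow> 'a \<Rightarrow> bool" where
  "cov p a b \<longleftrightarrow> E a b \<and> d p b = Suc (d p a)"

lemma cov_E: "cov p a b \<Longrightarrow> E a b"
  and cov_E': "cov p a b \<Longrightarrow> E b a"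
  and cov_d: "cov p a b \<Longrightarrow> d p b = Suc (d p a)"
  using sym by (auto simp: cov_def)

lemma cov_ex:
  assumes "d p x = Suc n"
  obtains y where "cov p y x" "d p y = n"
  using d_step'[OF assms] assms by (auto simp: cov_def)

text \<open>So every edge lies in a unique maximal clique; these cliques are the lines of the
  geometry.\<close>

lemma K4:
  assumes "E a b" "E a c" "E b c" "E a e" "E b e" "c \<noteq> e"
  shows "E c e"
proof (rule ccontr)
  assume "\<not> E c e"
  moreover have "distinct [a, b, c, e]" using assms by auto
  ultimately have "has_induced_K4_minus E"
    unfolding has_induced_K4_minus_def using assms by blast
  then show False using swm by (simp add: swm_graph_def)
qed

text \<open>At level 1, where the axiom is silent, \<open>u\<close> itself is the common lower
  neighbour. \<open>QC\<close> is completed in the same way.\<close>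

lemma TC:
  assumes "E v w" "d u v = d u w" "d u v \<noteq> 0"
  obtains x where "cov u x v" "cov u x w"
proof (cases "d u v = 1")
  case True
  then have "E u v" "E u w" using assms(2) d_1[of u v] d_1[of u w] by metis+
  then show ?thesis using that[of u] True assms by (simp add: cov_def)
next
  case False
  then have "d v w = 1 \<and> 1 < d u v \<and> d u v = d u w"
    using assms d_1[of v w] by (metis less_one linorder_neqE_nat)
  then obtain x where "E x v" "E x w" "d u x = d u v - 1"
    using swm unfolding swm_graph_def weakly_modular_def by metis
  then show ?thesis using that[of x] assms by (simp add: cov_def)
qed

text \<open>If \<open>z\<close> were level with \<open>w\<close>, a common lower neighbour of the
  two would by \<open>K4\<close> be adjacent to \<open>v\<close>, two levels above it. So a line
  meeting two levels has a single vertex on the lower one.\<close>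

lemma line:
  assumes "cov u w v" "E z v" "E z w"
  shows "d u z = d u v"
proof (rule ccontr)
  assume "d u z \<noteq> d u v"
  moreover have "d u v = Suc (d u w)" "E w v" using assms by (auto simp: cov_def)
  ultimately have eq: "d u z = d u w"
    using d_lip[OF assms(3), of u] d_lip[OF sym[OF assms(2)], of u] by linarith
  have "d u w \<noteq> 0"
  proof
    assume "d u w = 0"
    then have "u = w" "u = z" using eq by auto
    then show False using assms(3) by simp
  qed
  then obtain x where x: "cov u x z" "cov u x w" using TC[OF assms(3) eq] eq by auto
  then have "d u v = d u x + 2" using \<open>d u v = Suc (d u w)\<close> cov_d by fastforce
  moreover from this have "E x v"
    using K4[of z w x v] sym[OF cov_E[OF x(1)]] sym[OF cov_E[OF x(2)]] assms \<open>E w v\<close> by fastforce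
  then have "d u v \<le> d u x + 1" using sym d_lip by blast
  ultimately show False by simp
qed

lemma lower_not_adj:
  assumes "cov u v z" "cov u w z"
  shows "\<not> E v w"
  using line[OF assms(1) cov_E[OF assms(2)]] assms by (auto simp: cov_def sym_iff)

lemma lower_d2:
  assumes "cov u v z" "cov u w z" "v \<noteq> w"
  shows "d v w = 2"
  using d_eq_2I[of v z w] lower_not_adj[OF assms(1,2)] assms by (auto simp: cov_def sym_iff)

lemma QC:
  assumes "cov u v z" "cov u w z" "v \<noteq> w"
  obtains x where "cov u x v" "cov u x w"
proof (cases "d u v \<le> 1")
  case True
  have "d u v = d u w" using assms by (simp add: cov_def)
  with assms True have "d u v = 1" by (cases "d u v") auto
  then have "E u v" "E u w" using \<open>d u v = d u w\<close> d_1[of u v] d_1[of u w] by metis+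
  then show ?thesis using that[of u] \<open>d u v = 1\<close> \<open>d u v = d u w\<close> by (simp add: cov_def)
next
  case False
  have "d v w = 2" using lower_d2 assms by blast
  with False have "d v z = 1 \<and> d w z = 1 \<and> d v w = 2 \<and> 2 \<le> d u v \<and>
        d u v = d u w \<and> d u z = d u v + 1" using assms by (auto simp: cov_def d_1 simp del: One_nat_def)
  then obtain x where "E x v" "E x w" "d u x = d u v - 1"
    using swm unfolding swm_graph_def weakly_modular_def by metis
  moreover have "d u v = d u w" using assms by (simp add: cov_def)
  ultimately show ?thesis using that[of x] False by (simp add: cov_def)
qed

lemma cov_trans_d:
  assumes "cov u a b" "cov u b c"
  shows "d a c = 2"
proof -
  have *: "d u c = d u a + 2" using assms by (simp add: cov_def)
  then have "a \<noteq> c" by auto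
  moreover have "\<not> E a c" using * d_lip[of c a u] sym by fastforce
  ultimately show ?thesis using d_eq_2I assms cov_E by metis
qed

text \<open>Below two different meets the quadrangle condition gives \<open>y\<close>, and
  \<open>z\<close>, \<open>x\<close>, \<open>x'\<close> against \<open>y\<close>, \<open>v\<close>,
  \<open>w\<close> form an isometric K_{3,3} without the edge between \<open>z\<close> and
  \<open>y\<close>.\<close>

lemma meet_unique:
  assumes "cov u v z" "cov u w z" "v \<noteq> w"
    and "cov u x v" "cov u x w" "cov u x' v" "cov u x' w"
  shows "x = x'"
proof (rule ccontr)
  assume ne: "x \<noteq> x'"
  obtain y where y: "cov u y x" "cov u y x'" using QC[OF assms(4,6) ne] by blast
  have d3: "d y z = 3"
  proof -
    have "d u z = d u y + 3" using assms y by (simp add: cov_def)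
    then have "d y z \<ge> 3" using d_triangle[of u z y] by simp
    moreover have "d y z \<le> d y v + 1" using d_lip[of z v y] assms by (auto simp: cov_def sym_iff)
    moreover have "d y v = 2" using cov_trans_d y assms by blast
    ultimately show ?thesis by simp
  qed
  let ?a = "\<lambda>i::nat. if i = 1 then z else if i = 2 then x else x'"
  let ?b = "\<lambda>i::nat. if i = 1 then y else if i = 2 then v else w"
  have dist: "d z y = 3" "d z v = 1" "d z w = 1" "d x y = 1" "d x v = 1" "d x w = 1"
    "d x' y = 1" "d x' v = 1" "d x' w = 1"
    using d3 assms[unfolded cov_def] y[unfolded cov_def] by (simp_all add: d_sym[of z] d_1 sym del: One_nat_def)
  have "d z x = 2" "d z x' = 2" "d x x' = 2" "d y v = 2" "d y w = 2" "d v w = 2"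
    using cov_trans_d[OF assms(4) assms(1)] cov_trans_d[OF assms(6) assms(1)] lower_d2[OF assms(4,6) ne]
      cov_trans_d[OF y(1) assms(4)] cov_trans_d[OF y(1) assms(5)] lower_d2[OF assms(1-3)]
    by (auto simp: d_sym[of z])
  moreover from this have "d x z = 2" "d x' z = 2" "d x' x = 2" "d v y = 2" "d w y = 2" "d w v = 2"
    by (simp_all add: d_sym)
  ultimately have "has_isometric_K33_minus E"
    unfolding has_isometric_K33_minus_def
    using dist by (intro exI[of _ ?a] exI[of _ ?b]) simp
  then show False using swm by (simp add: swm_graph_def)
qed

section \<open>Local closedness and gates\<close>

text \<open>In a weakly modular graph a connected set is gated iff it is closed in this sense.\<close>
definition closed :: "'a set \<Rightarrow> bool" where
  "closed X \<longleftrightarrow> (\<forall>x v w. v \<in> X \<longrightarrow> w \<in> X \<longrightarrow> v \<noteq> w \<longrightarrow> E x v \<longrightarrow> E x w \<longrightarrow> x \<in> X)"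

lemma closedD: "closed X \<Longrightarrow> v \<in> X \<Longrightarrow> w \<in> X \<Longrightarrow> v \<noteq> w \<Longrightarrow> E x v \<Longrightarrow> E x w \<Longrightarrow> x \<in> X"
  unfolding closed_def by metis

abbreviation conn_in :: "'a set \<Rightarrow> 'a \<Rightarrow> 'a \<Rightarrow> bool" where
  "conn_in X \<equiv> (\<lambda>a b. E a b \<and> a \<in> X \<and> b \<in> X)\<^sup>*\<^sup>*"

lemma conn_in_sym: "conn_in X a b \<Longrightarrow> conn_in X b a"
  by (erule sympD[OF symp_rtranclp, rotated]) (metis (no_types, lifting) sym sympI)

text \<open>A minimal counterexample to \<open>d x y = d x g + l y\<close>, where \<open>l\<close> is the distance from \<open>g\<close> inside
  \<open>X\<close>, is excluded by the triangle and quadrangle conditions with respect to \<open>x\<close>.\<close>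
lemma closed_gate:
  assumes cl: "closed X" and g: "g \<in> X" and min: "\<And>y. y \<in> X \<Longrightarrow> d x g \<le> d x y"
    and l: "\<And>y. y \<in> X \<Longrightarrow> l y = 0 \<Longrightarrow> y = g"
      "\<And>y z. y \<in> X \<Longrightarrow> z \<in> X \<Longrightarrow> E y z \<Longrightarrow> l z \<le> l y + 1"
      "\<And>y n. y \<in> X \<Longrightarrow> l y = Suc n \<Longrightarrow> \<exists>z\<in>X. E z y \<and> l z = n"
    and y: "y \<in> X"
  shows "d x y = d x g + l y"
  using y
proof (induction "l y" arbitrary: y rule: less_induct)
  case less
  note IH = less.hyps
  show ?case
  proof (cases "l y")
    case 0
    then show ?thesis using l(1) less.prems by simp
  next
    case (Suc n)
    obtain y1 where y1: "y1 \<in> X" "E y1 y" "l y1 = n" using l(3)[OF less.prems Suc] by blast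
    have dy1: "d x y1 = d x g + n" using IH[of y1] y1 Suc by simp
    have yX: "y \<in> X" by (rule less.prems)
    have up: "d x y \<le> d x g + l y" using d_lip[OF sym[OF y1(2)], of x] dy1 Suc by simp
    show ?thesis
    proof (rule ccontr)
      assume "d x y \<noteq> d x g + l y"
      then have lt: "d x y \<le> d x y1" using up Suc dy1 by simp
      show False
      proof (cases n)
        case 0
        then have "y1 = g" using l(1) y1 by simp
        then have eq: "d x y1 = d x y" using lt min[OF yX] by simp
        show False
        proof (cases "d x y = 0")
          case True
          then show False using eq y1 by auto
        next
          case False
          then obtain z where z: "cov x z y1" "cov x z y" using TC[OF y1(2) eq] eq by auto
          then have "z \<in> X" using closedD[OF cl y1(1) yX _ cov_E[OF z(1)] cov_E[OF z(2)]] y1 by fastforce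
          then show False using min[of z] z \<open>y1 = g\<close> by (auto simp: cov_def)
        qed
      next
        case (Suc m)
        obtain y2 where y2: "y2 \<in> X" "E y2 y1" "l y2 = m" using l(3)[OF y1(1)] y1 Suc by blast
        have dy2: "d x y2 = d x g + m" using IH[of y2] y2 Suc \<open>l y = Suc n\<close> by simp
        have c2: "cov x y2 y1" using y2 dy2 dy1 Suc by (simp add: cov_def)
        \<comment> \<open>The induction hypothesis fixes \<open>l\<close> on the vertices of
          \<open>X\<close> below \<open>y2\<close>. In both cases such an \<open>s\<close> is joined
          to \<open>y\<close> inside \<open>X\<close> by a walk too short for
          \<open>l y = Suc n\<close>.\<close>
        have low: "l s + 1 = m" if "cov x s y2" "s \<in> X" for s
        proof -
          have "l s \<le> n" using l(2)[OF y2(1) that(2)] that(1) sym y2 Suc by (auto simp: cov_def)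
          then have "d x s = d x g + l s" using IH[of s] that \<open>l y = Suc n\<close> by simp
          then show ?thesis using cov_d[OF that(1)] dy2 by simp
        qed
        show False
        proof (cases "d x y = d x y1")
          case True
          obtain z where z: "cov x z y1" "cov x z y"
            using TC[OF y1(2) True[symmetric]] dy1 Suc by auto
          have zX: "z \<in> X" using closedD[OF cl y1(1) yX _ cov_E[OF z(1)] cov_E[OF z(2)]] y1 by fastforce
          have lz: "l y \<le> l z + 1" using l(2)[OF zX yX] z cov_E by blast
          then have ne: "z \<noteq> y2" using y2 \<open>l y = Suc n\<close> Suc by auto
          obtain s where s: "cov x s z" "cov x s y2" using QC[OF z(1) c2 ne] by blast
          have sX: "s \<in> X" using closedD[OF cl zX y2(1) ne] s cov_E by blast
          show False using low[OF s(2) sX] l(2)[OF sX zX cov_E[OF s(1)]] lz \<open>l y = Suc n\<close> Suc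
            by linarith
        next
          case False
          then have c: "cov x y y1" using lt d_lip[OF y1(2), of x] sym[OF y1(2)] by (simp add: cov_def)
          have ne: "y \<noteq> y2" using y2 \<open>l y = Suc n\<close> Suc by auto
          obtain s where s: "cov x s y" "cov x s y2" using QC[OF c c2 ne] by blast
          have sX: "s \<in> X" using closedD[OF cl yX y2(1) ne] s cov_E by blast
          show False using low[OF s(2) sX] l(2)[OF sX yX cov_E[OF s(1)]] \<open>l y = Suc n\<close> Suc
            by linarith
        qed
      qed
    qed
  qed
qed

section \<open>Gated sets\<close>

text \<open>The gate is a vertex \<open>g\<close> of \<open>X\<close> nearest to \<open>x\<close>.
  By \<open>closed_gate\<close>, \<open>d x y\<close> exceeds \<open>d x g\<close> by the distance
  from \<open>g\<close> to \<open>y\<close> inside \<open>X\<close>, which is at least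
  \<open>d g y\<close>; the triangle inequality does the rest.\<close>

lemma gatedI:
  assumes "p \<in> X" "closed X" and conn: "\<And>z. z \<in> X \<Longrightarrow> conn_in X p z"
  shows "gated E X"
  unfolding gated_def
proof
  fix x
  obtain g where g: "g \<in> X" and min: "\<And>y. y \<in> X \<Longrightarrow> d x g \<le> d x y"
    using ex_has_least_nat[of "\<lambda>y. y \<in> X" p "d x"] assms by metis
  define R where "R = (\<lambda>a b. E a b \<and> a \<in> X \<and> b \<in> X)"
  define l where "l y = (LEAST n. (R ^^ n) g y)" for y
  have l: "(R ^^ l y) g y" if y: "y \<in> X" for y
  proof -
    have "conn_in X g y"
      by (rule rtranclp_trans[OF conn_in_sym[OF conn[OF g]] conn[OF y]])
    then have "\<exists>n. (R ^^ n) g y" unfolding R_def rtranclp_power .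
    then show ?thesis unfolding l_def by (rule LeastI_ex)
  qed
  have l_le: "l y \<le> n" if "(R ^^ n) g y" for n y
    unfolding l_def using that by (rule Least_le)
  have "d x y = d x g + l y" if y: "y \<in> X" for y
  proof (rule closed_gate[OF assms(2) g min _ _ _ y])
    show "y = g" if "y \<in> X" "l y = 0" for y using l[OF that(1)] that(2) by simp
    show "l z \<le> l y + 1" if "y \<in> X" "z \<in> X" "E y z" for y z
    proof -
      have "R y z" using that by (simp add: R_def)
      then have "(R ^^ Suc (l y)) g z" using l[OF that(1)] by auto
      then show ?thesis using l_le by fastforce
    qed
    show "\<exists>z\<in>X. E z y \<and> l z = n" if y: "y \<in> X" and ly: "l y = Suc n" for y n
    proof -
      have "(R ^^ Suc n) g y" using l[OF y] ly by simp
      then obtain z where z: "(R ^^ n) g z" "R z y" by auto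
      then have "z \<in> X" "E z y" by (auto simp: R_def)
      moreover have "l z \<le> n" using z l_le by blast
      moreover have "l y \<le> Suc (l z)"
      proof (rule l_le)
        show "(R ^^ Suc (l z)) g y" using l[OF \<open>z \<in> X\<close>] z(2) by auto
      qed
      ultimately show ?thesis using ly by (metis Suc_le_mono le_antisym)
    qed
  qed
  moreover have "d g y \<le> l y" if y: "y \<in> X" for y
  proof -
    have "(E ^^ n) g y" if "(R ^^ n) g y" for n y
      using that by (induction n arbitrary: y) (auto simp: R_def)
    then show ?thesis using l[OF y] d_le by blast
  qed
  ultimately have "d x g + d g y = d x y" if "y \<in> X" for y
    using d_triangle[of x y g] that by fastforce
  then have "is_gate E X x g" unfolding is_gate_def mem_interval using g by blast
  then show "\<exists>g. is_gate E X x g" by blast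
qed

lemma is_gate_unique: "is_gate E X x g \<Longrightarrow> is_gate E X x h \<Longrightarrow> g = h"
proof -
  assume "is_gate E X x g" "is_gate E X x h"
  then have "d x g + d g h = d x h" "d x h + d h g = d x g"
    by (auto simp: is_gate_def mem_interval)
  then have "d g h = 0" by linarith
  then show ?thesis by simp
qed

lemma gate_eq: "is_gate E X x g \<Longrightarrow> gate E X x = g"
  unfolding gate_def using is_gate_unique by blast

lemma gate: "gated E X \<Longrightarrow> is_gate E X x (gate E X x)"
  using gate_eq unfolding gated_def by metis

lemma gate_mem: "gated E X \<Longrightarrow> gate E X x \<in> X"
  using gate[of X x] by (simp add: is_gate_def)

lemma gate_d: "gated E X \<Longrightarrow> y \<in> X \<Longrightarrow> d x y = d x (gate E X x) + d (gate E X x) y"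
  using gate[of X x] by (simp add: is_gate_def mem_interval)

lemma gate_self: "gated E X \<Longrightarrow> x \<in> X \<Longrightarrow> gate E X x = x"
  using gate_d[of X x x] by simp

lemma gate_eqI:
  assumes X: "gated E X" and "x \<notin> X" "E x g" "g \<in> X"
  shows "gate E X x = g"
proof -
  have "d x (gate E X x) \<noteq> 0" using gate_mem[OF X, of x] assms by auto
  then have "d (gate E X x) g = 0" using gate_d[OF X \<open>g \<in> X\<close>, of x] d_1[of x g] \<open>E x g\<close> by linarith
  then show ?thesis by simp
qed

lemma gated_convex:
  assumes "gated E X" "u \<in> X" "v \<in> X" "w \<in> interval E u v"
  shows "w \<in> X"
proof -
  let ?g = "gate E X w"
  have "d w u = d w ?g + d ?g u" "d w v = d w ?g + d ?g v"
    using gate_d[OF assms(1,2)] gate_d[OF assms(1,3)] by blast+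
  moreover have "d u w + d w v = d u v" using assms by (simp add: mem_interval)
  moreover have "d u v \<le> d u ?g + d ?g v" by (rule d_triangle)
  ultimately have "d w ?g = 0" using d_sym[of u w] d_sym[of u ?g] by linarith
  then show ?thesis using gate_mem[OF assms(1), of w] by simp
qed

lemma gated_closed:
  assumes "gated E X" shows "closed X"
  unfolding closed_def using gate_eqI[OF assms] by blast

lemma conn_interval:
  assumes "\<And>w. w \<in> interval E u v \<Longrightarrow> w \<in> X"
  shows "conn_in X u v"
  using assms
proof (induction "d u v" arbitrary: v)
  case 0
  then have "u = v" by simp
  then show ?case by simp
next
  case (Suc n)
  obtain w where w: "cov u w v" "d u w = n" using cov_ex Suc(2) by metis
  have sub: "z \<in> X" if "z \<in> interval E u w" for z
  proof (rule Suc.prems)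
    have "d u z + d z w = n" using that w by (simp add: mem_interval)
    moreover have "d z v \<le> d z w + 1" using d_lip[OF cov_E'[OF w(1)]] .
    ultimately show "z \<in> interval E u v" using Suc(2) d_triangle[of u v z]
      by (simp add: mem_interval)
  qed
  have "v \<in> X" using Suc.prems[of v] by (simp add: mem_interval)
  moreover have "w \<in> X" using sub[of w] by (simp add: mem_interval)
  ultimately show ?case
    using Suc.hyps(1)[of w] w sub by (auto simp: cov_def intro: rtranclp.rtrancl_into_rtrancl)
qed

text \<open>Connectedness, which intersections need not inherit, comes from convexity: an interval
  between common points lies in every member.\<close>

lemma gated_Inter:
  assumes "\<And>X. X \<in> F \<Longrightarrow> gated E X" "p \<in> \<Inter>F"
  shows "gated E (\<Inter>F)"
proof (rule gatedI[OF assms(2)])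
  show "closed (\<Inter>F)"
    unfolding closed_def
  proof (intro allI impI InterI)
    fix x v w X assume *: "v \<in> \<Inter>F" "w \<in> \<Inter>F" "v \<noteq> w" "E x v" "E x w" "X \<in> F"
    then show "x \<in> X" using closedD[OF gated_closed[OF assms(1)[OF \<open>X \<in> F\<close>]], of v w x] by blast
  qed
  show "conn_in (\<Inter>F) p z" if z: "z \<in> \<Inter>F" for z
  proof (rule conn_interval, rule InterI)
    fix w X assume "w \<in> interval E p z" "X \<in> F"
    then show "w \<in> X" using gated_convex[OF assms(1), of X p z w] assms(2) z by blast
  qed
qed

lemma hull:
  shows gated_hull: "gated E (gated_hull2 E x y)"
    and hull_left: "x \<in> gated_hull2 E x y" and hull_right: "y \<in> gated_hull2 E x y"
proof -
  show "x \<in> gated_hull2 E x y" "y \<in> gated_hull2 E x y" by (auto simp: gated_hull2_def)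
  then show "gated E (gated_hull2 E x y)"
    unfolding gated_hull2_def by (intro gated_Inter) auto
qed

lemma hull_subset: "gated E X \<Longrightarrow> x \<in> X \<Longrightarrow> y \<in> X \<Longrightarrow> gated_hull2 E x y \<subseteq> X"
  by (auto simp: gated_hull2_def)

lemma hull_sym: "gated_hull2 E x y = gated_hull2 E y x"
  by (simp add: gated_hull2_def conj_commute)

lemma interval_hull: "z \<in> interval E x y \<Longrightarrow> z \<in> gated_hull2 E x y"
  by (rule gated_convex[OF gated_hull hull_left hull_right])

section \<open>Thick pairs\<close>

text \<open>Seen from \<open>v\<close> at distance 2, the common lower neighbour has level 1 and is
  adjacent to \<open>v\<close> itself. Together with \<open>QC2\<close> this builds vertices from
  base points other than \<open>p\<close>.\<close>

lemma TC2:
  assumes "E s c" "d v s = 2" "d v c = 2"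
  obtains x where "E x s" "E x c" "E x v"
proof -
  obtain x where x: "cov v x s" "cov v x c" using TC[OF assms(1), of v] assms by auto
  then have "d v x = 1" using cov_d[OF x(1)] assms by simp
  then show ?thesis using that x cov_E d_1 sym by blast
qed

lemma QC2:
  assumes "E v z" "E w z" "v \<noteq> w" "d u v = 2" "d u w = 2" "d u z = 3"
  obtains x where "E x v" "E x w" "E x u"
proof -
  have "cov u v z" "cov u w z" using assms by (simp_all add: cov_def)
  then obtain x where x: "cov u x v" "cov u x w" using QC[OF _ _ assms(3)] by blast
  then have "d u x = 1" using cov_d[OF x(1)] assms by simp
  then show ?thesis using that x cov_E d_1 sym by blast
qed

lemma cov_interval: "cov p c z \<Longrightarrow> c \<in> interval E p z"
  using d_1[of c z] by (simp add: cov_def mem_interval)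

lemma interval_trans:
  assumes "y \<in> interval E p z" "w \<in> interval E p y"
  shows "w \<in> interval E p z"
  using assms d_triangle[of w z y] d_triangle[of p z w] unfolding mem_interval by linarith

lemma lower_between:
  assumes "w \<in> interval E p z" "w \<noteq> z"
  obtains c where "cov p c z" "w \<in> interval E p c"
proof -
  obtain n where n: "d w z = Suc n" using assms(2) d_0[of w z] by (metis not0_implies_Suc)
  obtain c where c: "E c z" "d w c = n" using d_step'[OF n] by blast
  have "d p w + Suc n = d p z" using assms(1) n by (simp add: mem_interval)
  moreover have "d p c \<le> d p w + n" using d_triangle[of p c w] c by simp
  moreover have "d p z \<le> d p c + 1" using d_lip[OF sym[OF c(1)]] .
  ultimately have "d p c = d p w + n" by linarith
  then show ?thesis using that[of c] c n \<open>d p w + Suc n = d p z\<close> by (simp add: cov_def mem_interval)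
qed

lemma cov_between:
  assumes "E e s" "E e z" "d p z = d p s + 2"
  shows "cov p s e" "cov p e z"
  using assms d_lip[OF assms(1), of p] d_lip[OF sym[OF assms(2)], of p] sym[OF assms(1)]
  by (simp_all add: cov_def)

text \<open>The dimension-free form of a Boolean pair; see \<open>delta_edge_iff\<close> below.\<close>
definition thick :: "'a \<Rightarrow> 'a \<Rightarrow> bool" where
  "thick x y \<longleftrightarrow> (\<forall>u w. d u w = 2 \<and> d x u + 2 + d w y = d x y \<longrightarrow>
     (\<exists>a b. a \<noteq> b \<and> E a u \<and> E a w \<and> E b u \<and> E b w))"

lemma thick_ex:
  assumes "thick p z" "cov p s c" "cov p c w" "w \<in> interval E p z"
  obtains e where "e \<noteq> c" "cov p s e" "cov p e w"
proof -
  have "d s w = 2" using cov_trans_d assms by blast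
  moreover have eq: "d p w = d p s + 2" using assms by (simp add: cov_def)
  moreover have "d p s + 2 + d w z = d p z" using assms eq by (simp add: mem_interval)
  ultimately obtain a b where ab: "a \<noteq> b" "E a s" "E a w" "E b s" "E b w"
    using assms(1) unfolding thick_def by blast
  then show ?thesis using that[of a] that[of b] cov_between[OF _ _ eq] by metis
qed

lemma thick_mono:
  assumes "thick p z" "y \<in> interval E p z"
  shows "thick p y"
  unfolding thick_def
proof (intro allI impI)
  fix u w assume uw: "d u w = 2 \<and> d p u + 2 + d w y = d p y"
  then have "d w z \<le> d w y + d y z" "d p z \<le> d p u + d u w + d w z" "d p y + d y z = d p z"
    using assms(2) d_triangle[of w z y] d_triangle[of p z u] d_triangle[of u z w]
    by (auto simp: mem_interval)
  with uw have "d u w = 2 \<and> d p u + 2 + d w z = d p z" by linarith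
  then show "\<exists>a b. a \<noteq> b \<and> E a u \<and> E a w \<and> E b u \<and> E b w"
    using assms(1) unfolding thick_def by blast
qed

lemma thick_sym:
  assumes "thick x y" shows "thick y x"
  unfolding thick_def
proof (intro allI impI)
  fix u w assume "d u w = 2 \<and> d y u + 2 + d w x = d y x"
  then have "d w u = 2 \<and> d x w + 2 + d u y = d x y"
    using d_sym[of u w] d_sym[of y u] d_sym[of w x] d_sym[of x y] by linarith
  then show "\<exists>a b. a \<noteq> b \<and> E a u \<and> E a w \<and> E b u \<and> E b w"
    using assms unfolding thick_def by blast
qed

lemma thick_le1: "d p z \<le> 1 \<Longrightarrow> thick p z"
  by (auto simp: thick_def)

text \<open>A pair \<open>(u,w)\<close> with \<open>w\<close> different from \<open>z\<close>
  already lies below a lower neighbour of \<open>z\<close>, so only squares with top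
  \<open>z\<close> remain.\<close>

lemma thick_step:
  assumes low: "\<And>c. cov p c z \<Longrightarrow> thick p c"
    and second: "\<And>s c. cov p s c \<Longrightarrow> cov p c z \<Longrightarrow> \<exists>e. e \<noteq> c \<and> E e s \<and> E e z"
  shows "thick p z"
  unfolding thick_def
proof (intro allI impI)
  fix u w assume uw: "d u w = 2 \<and> d p u + 2 + d w z = d p z"
  then have w: "d p w = d p u + 2" "w \<in> interval E p z"
    using d_triangle[of p z w] d_triangle[of p w u] by (auto simp: mem_interval)
  obtain c where c: "E u c" "E c w" using d_2E uw by blast
  then have cc: "cov p u c" "cov p c w" using cov_between[of c u w p] sym w by auto
  show "\<exists>a b. a \<noteq> b \<and> E a u \<and> E a w \<and> E b u \<and> E b w"
  proof (cases "w = z")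
    case True
    then show ?thesis using second[OF cc(1)] cc c sym by metis
  next
    case False
    then obtain b where b: "cov p b z" "w \<in> interval E p b" using lower_between w by blast
    then obtain e where "e \<noteq> c" "cov p u e" "cov p e w" using thick_ex[OF low cc] by blast
    then show ?thesis using c by (metis cov_E cov_E' sym)
  qed
qed

section \<open>Adjacent vertices on one level\<close>

lemma line_lower_unique:
  assumes "E r v" "cov p t r" "cov p t v" "cov p y r" "cov p y v"
  shows "t = y"
  using K4[OF assms(1) cov_E'[OF assms(2)] cov_E'[OF assms(3)] cov_E'[OF assms(4)] cov_E'[OF assms(5)]]
    lower_not_adj[OF assms(2,4)] by blast

lemma below_line:
  assumes "E r v" "d p r = d p v" "cov p y r" "cov p y v"
    and "d p r = d p s + 2" "d s r = 2" "d s v = 2"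
  shows "E s y"
proof -
  obtain t where t: "E t r" "E t v" "E t s" using TC2[OF assms(1,6,7)] by blast
  have "cov p t r" "cov p t v" using cov_between[OF t(3)] t assms by auto
  then have "t = y" using line_lower_unique assms by blast
  then show ?thesis using t sym by blast
qed

text \<open>Moves the edge between \<open>x\<close> and \<open>v\<close> one level down, to a
  prescribed lower neighbour \<open>c\<close> of \<open>x\<close>. The triangle condition is used
  from \<open>v\<close>, which has distance 2 to both \<open>c\<close> and \<open>s\<close>.\<close>

lemma line_down:
  assumes "E x v" "cov p y x" "cov p y v" "cov p c x" "c \<noteq> y" "cov p s c" "cov p s y"
  obtains c' where "cov p s c'" "cov p c' v" "E c c'"
proof -
  have dv: "d p v = d p s + 2" "d p x = d p v" using assms by (simp_all add: cov_def)
  have "\<not> E c v"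
  proof
    assume "E c v"
    then have "cov p c v" using assms dv by (simp add: cov_def)
    then show False using line_lower_unique assms by blast
  qed
  moreover have "c \<noteq> v" using assms dv by (auto simp: cov_def)
  ultimately have "d v c = 2" using d_eq_2I[of v x c] assms sym cov_E' by blast
  moreover have "d v s = 2" using cov_trans_d[OF assms(7,3)] d_sym by simp
  ultimately obtain t where t: "E t s" "E t c" "E t v" using TC2[OF cov_E[OF assms(6)]] by blast
  show ?thesis using that[of t] cov_between[OF t(1,3) dv(1)] sym t by blast
qed

text \<open>The predicate is a parameter because the scheme serves \<open>thick p\<close> and the
  predicate inside \<open>hull_neighbour\<close>. A lower neighbour of \<open>r\<close> is either
  the common lower neighbour \<open>y\<close> or, by \<open>line_down\<close>, adjacent to a vertex
  of its own level below \<open>v\<close>; so \<open>lim\<close> may assume \<open>Q\<close> for all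
  of them.\<close>

lemma same_level_induct:
  assumes her: "\<And>z y. Q z \<Longrightarrow> y \<in> interval E p z \<Longrightarrow> Q y"
    and base: "\<And>v r. Q v \<Longrightarrow> E v r \<Longrightarrow> d p v = 1 \<Longrightarrow> d p r = 1 \<Longrightarrow> Q r"
    and lim: "\<And>v r. Q v \<Longrightarrow> E r v \<Longrightarrow> d p r = d p v \<Longrightarrow> 2 \<le> d p r \<Longrightarrow>
      (\<And>c. cov p c r \<Longrightarrow> Q c) \<Longrightarrow> Q r"
    and "Q v" "E r v" "d p r = d p v"
  shows "Q r"
  using assms(4-6)
proof (induction "d p r" arbitrary: r v rule: less_induct)
  case less
  have d0: "d p r \<noteq> 0"
  proof
    assume "d p r = 0"
    then have "r = p" "v = p" using less by auto
    then show False using less by simp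
  qed
  show ?case
  proof (cases "d p r = 1")
    case True
    then show ?thesis using base[OF less(2) sym[OF less(3)]] less by simp
  next
    case False
    with d0 have ge2: "2 \<le> d p r" by linarith
    obtain y where y: "cov p y r" "cov p y v" using TC[OF less(3,4) d0] by blast
    show ?thesis
    proof (rule lim[OF less(2-4) ge2])
      fix c assume c: "cov p c r"
      show "Q c"
      proof (cases "c = y")
        case True
        then show ?thesis using her[OF less(2)] cov_interval y by blast
      next
        case False
        then obtain s where s: "cov p s c" "cov p s y" using QC[OF c y(1)] by blast
        obtain c' where c': "cov p s c'" "cov p c' v" "E c c'"
          using line_down[OF less(3) y c False s] by blast
        show ?thesis
        proof (rule less.hyps[of c c'])
          show "d p c < d p r" using cov_d[OF c] by simp
          show "Q c'" using her[OF less(2)] cov_interval c' by blast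
          show "d p c = d p c'" using cov_d[OF s(1)] cov_d[OF c'(1)] by simp
        qed (rule c')
      qed
    qed
  qed
qed

text \<open>For \<open>s'\<close> below \<open>c\<close> below \<open>r\<close>, the second middle
  vertex is \<open>y\<close> when \<open>c\<close> is not \<open>y\<close> and \<open>s'\<close> is
  their meet. Otherwise a second middle vertex found below \<open>v\<close> is carried across the
  edge from \<open>v\<close> to \<open>r\<close>.\<close>

lemma thick_same_level:
  assumes "thick p v" "E r v" "d p r = d p v"
  shows "thick p r"
proof (rule same_level_induct[of "thick p" p, OF _ _ _ assms])
  show "thick p y" if "thick p z" "y \<in> interval E p z" for z y using thick_mono that .
  show "thick p r" if "d p r = 1" for r using thick_le1 that by simp
next
  fix v r
  assume v: "thick p v" and rv: "E r v" and eq: "d p r = d p v" and "2 \<le> d p r"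
    and low: "\<And>c. cov p c r \<Longrightarrow> thick p c"
  then have "d p r \<noteq> 0" by linarith
  then obtain y where y: "cov p y r" "cov p y v" using TC[OF rv eq] by blast
  have vv: "v \<in> interval E p v" by (simp add: mem_interval)
  show "thick p r"
  proof (rule thick_step[OF low])
    fix s' c assume s'c: "cov p s' c" and c: "cov p c r"
    have ds': "d p r = d p s' + 2" using s'c c by (simp add: cov_def)
    have ds'r: "d s' r = 2" using cov_trans_d[OF s'c c] .
    show "\<exists>e. e \<noteq> c \<and> E e s' \<and> E e r"
    proof (cases "c = y")
      case True
      obtain c' where c': "c' \<noteq> y" "cov p s' c'" "cov p c' v"
        using thick_ex[OF v _ y(2) vv] s'c True by blast
      have "\<not> E r c'"
      proof
        assume "E r c'"
        then have "cov p c' r" using c' eq sym by (simp add: cov_def)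
        then show False using line_lower_unique[OF rv _ c'(3) y] c' by blast
      qed
      moreover have "r \<noteq> c'" using c' eq by (auto simp: cov_def)
      ultimately have "d r c' = 2" using d_eq_2I[OF rv cov_E'[OF c'(3)]] by blast
      then obtain e where e: "E e s'" "E e c'" "E e r"
        using TC2[OF cov_E[OF c'(2)], of r] ds'r d_sym by metis
      have "e \<noteq> y" using lower_not_adj[OF y(2) c'(3)] e by blast
      then show ?thesis using e True by blast
    next
      case False
      then obtain s where s: "cov p s c" "cov p s y" using QC[OF c y(1)] by blast
      obtain c' where c': "cov p s c'" "cov p c' v" "E c c'"
        using line_down[OF rv y c False s] by blast
      have c'y: "c' \<noteq> y" using lower_not_adj[OF c y(1)] c' by blast
      show ?thesis
      proof (cases "s' = s")
        case True
        then show ?thesis using False cov_E'[OF s(2)] cov_E[OF y(1)] by metis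
      next
        case ne: False
        have s'y: "\<not> E s' y"
        proof
          assume "E s' y"
          then have "cov p s' y" using s s'c by (simp add: cov_def)
          then show False using meet_unique[OF c y(1) False s'c _ s] ne by blast
        qed
        \<comment> \<open>Moving the edge from \<open>c\<close> to \<open>c'\<close> down gives
          \<open>s''\<close> beside \<open>s'\<close> and below \<open>v\<close>, where thickness
          applies and yields \<open>e'\<close>.\<close>
        obtain o' where o': "cov p o' s'" "cov p o' s" using QC[OF s'c s(1) ne] by blast
        obtain s'' where s'': "cov p o' s''" "cov p s'' c'" "E s' s''"
          using line_down[OF c'(3) s(1) c'(1) s'c ne o'] by blast
        obtain e' where e': "e' \<noteq> c'" "cov p s'' e'" "cov p e' v"
          using thick_ex[OF v s''(2) c'(2) vv] by blast
        have s''y: "\<not> E s'' y"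
        proof
          assume "E s'' y"
          then have "cov p s'' y" using s'' c' s by (simp add: cov_def)
          then have "s'' = s" using meet_unique[OF c'(2) y(2) c'y s''(2) _ c'(1) s(2)] by blast
          then show False using lower_not_adj[OF s'c s(1)] s'' by blast
        qed
        then have e'y: "e' \<noteq> y" using e' cov_E by blast
        have e'r: "\<not> E e' r"
        proof
          assume "E e' r"
          then have "cov p e' r" using e' eq by (simp add: cov_def)
          then show False using line_lower_unique[OF rv _ e'(3) y] e'y by blast
        qed
        have dv: "d p v = d p s'' + 2" using e' by (simp add: cov_def)
        have ds'': "d p s'' = d p s'" using dv ds' eq by simp
        have "d s' v \<noteq> 2" using below_line[OF rv eq y ds' ds'r] s'y by blast
        moreover have "d s' v \<le> 3" using d_lip[OF sym[OF rv], of s'] ds'r by simp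
        moreover have "d p v \<le> d p s' + d s' v" by (rule d_triangle)
        ultimately have ds'v: "d s' v = 3" using dv ds'' by simp
        have "\<not> E s' e'"
          using ds'v d_lip[OF cov_E'[OF e'(3)], of s'] d_1[of s' e'] by auto
        moreover have "s' \<noteq> e'" using e' ds'' by (auto simp: cov_def)
        ultimately have ds'e': "d s' e' = 2" using d_eq_2I[OF s''(3) cov_E[OF e'(2)]] by blast
        have e'ner: "e' \<noteq> r" using e' eq by (auto simp: cov_def)
        \<comment> \<open>Seen from \<open>s'\<close>, both \<open>e'\<close> and \<open>r\<close>
          are lower neighbours of \<open>v\<close>, at distance 2 and 3 respectively.\<close>
        obtain e where e: "E e e'" "E e r" "E e s'"
          using QC2[OF cov_E[OF e'(3)] rv e'ner ds'e' ds'r ds'v] by blast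
        \<comment> \<open>Otherwise, around the base point \<open>r\<close>, both \<open>c\<close>
          and \<open>v\<close> would be meets of \<open>c'\<close> and \<open>e'\<close> under
          \<open>s''\<close>.\<close>
        have "e \<noteq> c"
        proof
          assume ec: "e = c"
          have "d s'' v = 2" using cov_trans_d[OF e'(2,3)] .
          then have "d s'' r \<noteq> 2" using below_line[OF rv eq y _ _ \<open>d s'' v = 2\<close>] s''y dv eq by auto
          moreover have "d s'' r \<le> 3" using d_lip[OF rv, of s''] \<open>d s'' v = 2\<close> by simp
          moreover have "d p r \<le> d p s'' + d s'' r" by (rule d_triangle)
          ultimately have "d s'' r = 3" using dv eq by simp
          then have drs'': "d r s'' = 3" by (simp add: d_sym)
          have "d r c' \<le> 2" using d_lip[OF cov_E[OF c'(2)], of r] d_1[of r v] rv by simp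
          moreover have "d r s'' \<le> d r c' + 1" using d_lip[OF cov_E[OF s''(2)]] .
          ultimately have drc': "d r c' = 2" using drs'' by simp
          have "d r e' \<le> 2" using d_lip[OF cov_E[OF e'(3)], of r] d_1[of r v] rv by simp
          moreover have "d r s'' \<le> d r e' + 1" using d_lip[OF cov_E[OF e'(2)]] .
          ultimately have dre': "d r e' = 2" using drs'' by simp
          have drc: "d r c = 1" "d r v = 1" using cov_E'[OF c] rv d_1 by blast+
          have "c = v"
          proof (rule meet_unique[of r c' s'' e'])
            show "cov r c' s''" "cov r e' s''"
              using drs'' drc' dre' cov_E'[OF s''(2)] cov_E'[OF e'(2)] by (simp_all add: cov_def)
            show "cov r c c'" "cov r c e'" "cov r v c'" "cov r v e'"
              using drc drc' dre' c'(3) e(1) ec cov_E'[OF c'(2)] cov_E'[OF e'(3)]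
              by (simp_all add: cov_def)
          qed (use e' in blast)
          then show False using c eq by (auto simp: cov_def)
        qed
        then show ?thesis using e by blast
      qed
    qed
  qed
qed

section \<open>Common upper neighbours\<close>

text \<open>Distance 1 would make \<open>v2\<close> a second meet of \<open>v\<close> and
  \<open>c\<close>; distance 2 would give a lower neighbour of \<open>x\<close> adjacent to
  \<open>c\<close>. The outcome is that \<open>QC2\<close> can be used from
  \<open>v2\<close>.\<close>

lemma above_square:
  assumes "cov p v x" "cov p c x" "v \<noteq> c" "cov p a v" "cov p a c" "cov p v2 v" "v2 \<noteq> a"
  shows "d v2 c = 3" "d v2 x = 2"
proof -
  show x2: "d v2 x = 2" using cov_trans_d assms by blast
  have dx: "d p x = d p v2 + 2" "d p c = d p v2 + 1" using assms by (simp_all add: cov_def)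
  have "d v2 c \<le> 3" using d_lip[OF cov_E[OF assms(2)], of v2] x2 by simp
  moreover have "d v2 c \<noteq> 0" using dx by auto
  moreover have "d v2 c \<noteq> 1"
  proof
    assume "d v2 c = 1"
    then have "cov p v2 c" using dx d_1 by (simp add: cov_def)
    then show False using meet_unique[OF assms(1,2,3,6) _ assms(4,5)] assms(7) by blast
  qed
  moreover have "d v2 c \<noteq> 2"
  proof
    assume "d v2 c = 2"
    then obtain t where t: "E t c" "E t x" "E t v2" using TC2[OF cov_E[OF assms(2)] _ x2] by blast
    then have "cov p t x" using cov_between[OF t(3,2) dx(1)] by blast
    then show False using lower_not_adj[OF _ assms(2)] t by blast
  qed
  ultimately show "d v2 c = 3" by linarith
qed

text \<open>The difficult case is a lower neighbour \<open>c\<close> of \<open>z\<close> having the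
  same meet \<open>a\<close> with \<open>v\<close> and \<open>w\<close>, so that only one vertex
  below \<open>c\<close> is known to satisfy \<open>Q\<close>. Thickness then supplies another lower
  neighbour \<open>h\<close> of \<open>z\<close>, whose meet with \<open>c\<close> is not
  \<open>a\<close>. On level 2 there is no room below \<open>a\<close>, hence the hypothesis
  \<open>base\<close>.\<close>

lemma join_induct:
  assumes her: "\<And>z y. Q z \<Longrightarrow> y \<in> interval E p z \<Longrightarrow> Q y"
    and thick: "\<And>z. Q z \<Longrightarrow> thick p z"
    and base: "\<And>v w z. d p z = 2 \<Longrightarrow> cov p v z \<Longrightarrow> cov p w z \<Longrightarrow> v \<noteq> w \<Longrightarrow> Q v \<Longrightarrow> Q w \<Longrightarrow> Q z"
    and lim: "\<And>v w z. 3 \<le> d p z \<Longrightarrow> cov p v z \<Longrightarrow> cov p w z \<Longrightarrow> v \<noteq> w \<Longrightarrow>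
      (\<And>c. cov p c z \<Longrightarrow> Q c) \<Longrightarrow> Q z"
    and "Q v" "Q w" "v \<noteq> w" "cov p v z" "cov p w z"
  shows "Q z"
  using assms(5-9)
proof (induction "d p z" arbitrary: v w z rule: less_induct)
  case less
  note v = less(5) and w = less(6)
  have dz: "d p z = Suc (d p v)" "d p v = d p w" using v w by (simp_all add: cov_def)
  have "d p z \<noteq> 1"
  proof
    assume "d p z = 1"
    then have "p = v" "p = w" using dz by auto
    then show False using less by simp
  qed
  then consider "d p z = 2" | "3 \<le> d p z" using dz by linarith
  then show ?case
  proof cases
    case 1
    then show ?thesis using base v w less by blast
  next
    case 2
    show ?thesis
    proof (rule lim[OF 2 v w less(4)])
      fix c assume c: "cov p c z"
      show "Q c"
      proof (cases "c = v \<or> c = w")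
        case True
        then show ?thesis using less by blast
      next
        case False
        then have cv: "v \<noteq> c" and cw: "w \<noteq> c" by auto
        obtain a where a: "cov p a v" "cov p a c" using QC[OF v c cv] by blast
        obtain b where b: "cov p b w" "cov p b c" using QC[OF w c cw] by blast
        have Qa: "Q a" and Qb: "Q b" using her[OF less(2)] her[OF less(3)] cov_interval a b by blast+
        have lt: "d p c < d p z" using cov_d[OF c] by simp
        show ?thesis
        proof (cases "a = b")
          case False
          show ?thesis by (rule less.hyps[OF lt Qa Qb False a(2) b(2)])
        next
          case True
          have aw: "cov p a w" using b True by blast
          \<comment> \<open>As \<open>z\<close> has level at least 3, \<open>a\<close> is not
            \<open>p\<close>. Over a lower neighbour \<open>s\<close> of \<open>a\<close>, thickness
            gives \<open>v2\<close> and \<open>w2\<close> beside \<open>a\<close>.\<close>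
          obtain n where "d p a = Suc n"
            using 2 dz cov_d[OF a(1)] by (cases "d p a") auto
          then obtain s where s: "cov p s a" using cov_ex by metis
          obtain v2 where v2: "v2 \<noteq> a" "cov p s v2" "cov p v2 v"
            using thick_ex[OF thick[OF less(2)] s a(1)] mem_interval by auto
          obtain w2 where w2: "w2 \<noteq> a" "cov p s w2" "cov p w2 w"
            using thick_ex[OF thick[OF less(3)] s aw] mem_interval by auto
          have v2c: "d v2 c = 3" "d v2 z = 2" using above_square[OF v c cv a v2(3,1)] by blast+
          have v2w: "d v2 w = 3" using above_square[OF v w less(4) a(1) aw v2(3,1)] by blast
          have "v2 \<noteq> w2" using v2w w2(3) d_1[of v2 w] cov_E by auto
          moreover have "\<not> E v2 w2" using v2w d_lip[OF cov_E'[OF w2(3)], of v2] d_1[of v2 w2] by auto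
          ultimately have "d v2 w2 = 2" using d_eq_2I[OF cov_E'[OF v2(2)] cov_E[OF w2(2)]] by blast
          moreover have "z \<noteq> w2" using v2c(1) c \<open>d v2 w2 = 2\<close> w w2 by (auto simp: cov_def)
          ultimately obtain h where h: "E h z" "E h w2" "E h v2"
            using QC2[OF cov_E'[OF w] cov_E[OF w2(3)] _ v2c(2) _ v2w] by blast
          have dz2: "d p z = d p v2 + 2" "d p z = d p w2 + 2" using v v2 w w2 by (simp_all add: cov_def)
          have h': "cov p h z" "cov p v2 h" "cov p w2 h"
            using cov_between[OF h(3,1) dz2(1)] cov_between[OF h(2,1) dz2(2)] by blast+
          have Qv2: "Q v2" "Q w2"
            using her[OF less(2)] her[OF less(3)] cov_interval v2(3) w2(3) by blast+
          have "d p h < d p z" using cov_d[OF h'(1)] by simp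
          then have Qh: "Q h" using less.hyps[OF _ Qv2 \<open>v2 \<noteq> w2\<close> h'(2,3)] by blast
          have "h \<noteq> c" using v2c(1) h(3) d_1[of v2 c] sym by fastforce
          then obtain m where m: "cov p m h" "cov p m c" using QC[OF h'(1) c] by blast
          have "m \<noteq> a"
          proof
            assume "m = a"
            have "h \<noteq> v" 
            proof
              assume "h = v"
              then have "w2 = a"
                using meet_unique[OF v w less(4) _ w2(3) a(1) aw] h'(3) by blast
              then show False using w2 by blast
            qed
            then have "a = v2"
              using meet_unique[OF h'(1) v _ _ a(1) h'(2) v2(3)] m \<open>m = a\<close> by blast
            then show False using v2 by blast
          qed
          moreover have "Q m" using her[OF Qh] cov_interval m by blast
          ultimately show ?thesis using less.hyps[OF lt _ Qa _ m(2) a(2)] by blast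
        qed
      qed
    qed
  qed
qed

text \<open>Every \<open>c\<close> has a companion \<open>v'\<close> below \<open>z\<close>. If
  \<open>s\<close> is not their meet, a square below \<open>v'\<close> gives \<open>v2\<close> at
  distance 3 from \<open>c\<close>; the quadrangle condition from \<open>v2\<close> yields
  \<open>h\<close>, which is not \<open>c\<close> because it is adjacent to
  \<open>v2\<close>.\<close>

lemma thick_join_step:
  assumes v: "cov p v z" and w: "cov p w z" and "v \<noteq> w"
    and low: "\<And>c. cov p c z \<Longrightarrow> thick p c"
  shows "thick p z"
proof (rule thick_step[OF low])
  fix s c assume s: "cov p s c" and c: "cov p c z"
  obtain v' where v': "cov p v' z" "v' \<noteq> c" using v w \<open>v \<noteq> w\<close> by metis
  obtain a where a: "cov p a v'" "cov p a c" using QC[OF v'(1) c v'(2)] by blast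
  show "\<exists>e. e \<noteq> c \<and> E e s \<and> E e z"
  proof (cases "s = a")
    case True
    then show ?thesis using v' a cov_E cov_E' by blast
  next
    case False
    then obtain b where b: "cov p b s" "cov p b a" using QC[OF s a(2)] by blast
    have "v' \<in> interval E p v'" by (simp add: mem_interval)
    then obtain v2 where v2: "v2 \<noteq> a" "cov p b v2" "cov p v2 v'"
      using thick_ex[OF low[OF v'(1)] b(2) a(1)] by blast
    have d: "d v2 c = 3" "d v2 z = 2" using above_square[OF v'(1) c v'(2) a v2(3,1)] by blast+
    have "\<not> E v2 s" using d(1) d_lip[OF cov_E'[OF s], of v2] d_1[of v2 s] by auto
    moreover have "v2 \<noteq> s" using d(1) d_1[of s c] cov_E[OF s] by auto
    ultimately have "d v2 s = 2" using d_eq_2I[OF cov_E'[OF v2(2)] cov_E[OF b(1)]] by blast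
    moreover have "s \<noteq> z" using s c by (auto simp: cov_def)
    ultimately obtain h where h: "E h s" "E h z" "E h v2"
      using QC2[OF cov_E[OF s] cov_E'[OF c] _ _ d(2) d(1)] by blast
    have "h \<noteq> c" using d(1) h(3) d_1[of v2 c] sym by fastforce
    then show ?thesis using h by blast
  qed
qed

lemma thick_join:
  assumes "thick p v" "thick p w" "v \<noteq> w" "cov p v z" "cov p w z"
  shows "thick p z"
proof (rule join_induct[of "thick p" p, OF _ _ _ _ assms])
  show "thick p y" if "thick p z" "y \<in> interval E p z" for z y using thick_mono that .
  show "thick p z" if "d p z = 2" "cov p v z" "cov p w z" "v \<noteq> w" for v w z
  proof (rule thick_join_step[OF that(2-4)])
    show "thick p c" if "cov p c z" for c using cov_d[OF that] \<open>d p z = 2\<close> thick_le1 by simp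
  qed
  show "thick p z" if "cov p v z" "cov p w z" "v \<noteq> w" "\<And>c. cov p c z \<Longrightarrow> thick p c" for v w z
    using thick_join_step that by blast
qed

section \<open>Gated ideals and hulls of thick pairs\<close>

text \<open>If a neighbour of \<open>x\<close> in the ideal is above or level with \<open>x\<close>,
  then \<open>her\<close> or \<open>level\<close> applies; if both are below, \<open>join\<close>
  does. Intervals to \<open>p\<close> stay in the ideal and make it connected.\<close>

lemma ideal_gated:
  assumes "Q p" and her: "\<And>z y. Q z \<Longrightarrow> y \<in> interval E p z \<Longrightarrow> Q y"
    and level: "\<And>v r. Q v \<Longrightarrow> E r v \<Longrightarrow> d p r = d p v \<Longrightarrow> Q r"
    and join: "\<And>v w z. Q v \<Longrightarrow> Q w \<Longrightarrow> v \<noteq> w \<Longrightarrow> cov p v z \<Longrightarrow> cov p w z \<Longrightarrow> Q z"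
  shows "gated E {z. Q z}"
proof (rule gatedI[of p])
  show "closed {z. Q z}"
    unfolding closed_def
  proof (intro allI impI)
    fix x v w
    assume "v \<in> {z. Q z}" "w \<in> {z. Q z}" and ne: "v \<noteq> w" and v: "E x v" and w: "E x w"
    then have Q: "Q v" "Q w" by auto
    have "Q x \<or> cov p u x" if u: "Q u" "E x u" for u
    proof -
      consider "d p u = d p x" | "d p u = Suc (d p x)" | "d p x = Suc (d p u)"
        using d_lip[OF u(2), of p] d_lip[OF sym[OF u(2)], of p] by linarith
      then show ?thesis
      proof cases
        case 1
        then show ?thesis using level[OF u] by simp
      next
        case 2
        then have "cov p x u" using u by (simp add: cov_def)
        then show ?thesis using her[OF u(1)] cov_interval by blast
      next
        case 3
        then show ?thesis using u sym by (simp add: cov_def)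
      qed
    qed
    then have "Q x" using Q v w join[OF Q ne] by blast
    then show "x \<in> {z. Q z}" by simp
  qed
  show "conn_in {z. Q z} p z" if "z \<in> {z. Q z}" for z
    using conn_interval[of p z "{z. Q z}"] her[of z] that by blast
  show "p \<in> {z. Q z}" using assms(1) by simp
qed

lemma thick_gated: "gated E {z. thick p z}"
proof (rule ideal_gated)
  show "thick p p" by (simp add: thick_le1)
qed (fact thick_mono thick_same_level thick_join)+

text \<open>The gatedness of thick vertices is used twice: around \<open>x\<close> and
  \<open>y\<close>, to make \<open>u\<close> thick with both generators, and then around
  \<open>u\<close>.\<close>

lemma thick_hull:
  assumes "thick x y" "u \<in> gated_hull2 E x y" "v \<in> gated_hull2 E x y"
  shows "thick u v"
proof -
  have self: "thick z z" for z by (simp add: thick_le1)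
  have *: "thick a w" if "thick a x" "thick a y" "w \<in> gated_hull2 E x y" for a w
    using hull_subset[OF thick_gated, of x a y] that by auto
  have "thick u x" "thick u y"
    using *[OF self assms(1) assms(2)] *[OF thick_sym[OF assms(1)] self assms(2)] thick_sym by blast+
  then show ?thesis using * assms(3) by blast
qed

section \<open>Neighbours of x in the hull of a thick pair\<close>

text \<open>The points at distance at most \<open>d y x\<close> from \<open>y\<close> in the pencil of lines through \<open>x\<close> form a
  subspace of the local geometry at \<open>x\<close>.\<close>
lemma atoms_subspace:
  assumes xu: "d x u = 2"
    and t: "E t x" "E t u" and t1: "E t1 x" "E t1 u" and t2: "E t2 x" "E t2 u"
    and "t1 \<noteq> t2" and y1: "d y t1 \<le> d y x" and y2: "d y t2 \<le> d y x"
  shows "d y t \<le> d y x"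
proof (rule ccontr)
  assume "\<not> d y t \<le> d y x"
  then have dt: "d y t = Suc (d y x)" using d_lip[OF t(1), of y] by linarith
  have xt: "cov y x t" using dt sym t by (simp add: cov_def)
  have xu': "\<not> E x u" "x \<noteq> u" using xu d_1[of x u] by auto
  \<comment> \<open>Otherwise the triangle condition from \<open>e\<close> gives a neighbour of
    \<open>e\<close> forming a triangle with \<open>x\<close> and \<open>t\<close>; by
    \<open>line\<close> it is as far from \<open>y\<close> as \<open>t\<close>, which is too far for
    a neighbour of \<open>e\<close>.\<close>
  have far: "d e t \<noteq> 2" if e: "Suc (d y e) = d y x" "d e x = 2" for e
  proof
    assume "d e t = 2"
    then obtain f where f: "E f x" "E f t" "E f e" using TC2[OF sym[OF t(1)] e(2)] by blast
    then have "d y f = d y t" using line[OF xt] by blast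
    then show False using d_lip[OF f(3), of y] e dt by simp
  qed
  have "d y u \<le> Suc (d y x)" using d_lip[OF sym[OF t1(2)], of y] y1 by simp
  moreover have "d y t \<le> Suc (d y u)" using d_lip[OF t(2), of y] by simp
  ultimately consider "d y u = Suc (d y x)" | "d y u = d y x" using dt by linarith
  then show False
  proof cases
    case 1
    have "d y u \<le> d y t1 + 1" "d y u \<le> d y t2 + 1"
      using d_lip[OF sym[OF t1(2)], of y] d_lip[OF sym[OF t2(2)], of y] by blast+
    then have "d y t1 = d y x" "d y t2 = d y x" using 1 y1 y2 by linarith+
    then have tu: "cov y t1 u" "cov y t2 u" using t1 t2 1 by (simp_all add: cov_def)
    obtain q where q: "cov y q t1" "cov y q t2" using QC[OF tu \<open>t1 \<noteq> t2\<close>] by blast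
    have dq: "Suc (d y q) = d y x" using cov_d[OF q(1)] \<open>d y t1 = d y x\<close> by simp
    have "\<not> E q x"
      using K4[of q x t1 t2] cov_E[OF q(1)] cov_E[OF q(2)] sym[OF t1(1)] sym[OF t2(1)]
        \<open>t1 \<noteq> t2\<close> lower_not_adj[OF tu] by blast
    moreover have "q \<noteq> x" using dq by auto
    ultimately have qx: "d q x = 2" using d_eq_2I[OF cov_E[OF q(1)] t1(1)] by blast
    have qu: "d q u = 2" using cov_trans_d[OF q(1) tu(1)] .
    have "d q t \<le> 3" using d_lip[OF t(1), of q] qx by simp
    moreover have "d y t \<le> d y q + d q t" by (rule d_triangle)
    ultimately have "d q t = 3" using far[OF dq qx] dq dt by linarith
    \<comment> \<open>Around \<open>q\<close>, both \<open>t1\<close> and \<open>t2\<close> become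
      meets of \<open>x\<close> and \<open>u\<close> below \<open>t\<close>.\<close>
    then have "cov q x t" "cov q u t" using qx qu sym[OF t(1)] sym[OF t(2)] by (simp_all add: cov_def)
    moreover have "d q t1 = 1" "d q t2 = 1" using q cov_E d_1 by blast+
    then have "cov q t1 x" "cov q t1 u" "cov q t2 x" "cov q t2 u"
      using qx qu t1 t2 by (simp_all add: cov_def)
    ultimately show False using meet_unique[of q x t u t1 t2] xu' \<open>t1 \<noteq> t2\<close> by blast
  next
    case 2
    have ut: "cov y u t" using 2 dt sym[OF t(2)] by (simp add: cov_def)
    \<comment> \<open>Hence \<open>t1\<close> and \<open>t2\<close> are closer to \<open>y\<close>
      than \<open>x\<close>, and are two meets of \<open>x\<close> and \<open>u\<close> below
      \<open>t\<close>, this time around \<open>y\<close>.\<close>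
    have no: "d y s \<noteq> d y x" if s: "E s x" "E s u" for s
    proof
      assume eq: "d y s = d y x"
      have "d y s \<noteq> 0"
      proof
        assume "d y s = 0"
        then have "d y x = 0" "d y u = 0" using eq 2 by simp_all
        then show False using xu' by simp
      qed
      then obtain e where e: "cov y e s" "cov y e u" using TC[OF s(2)] eq 2 by metis
      have de: "Suc (d y e) = d y x" using cov_d[OF e(1)] eq by simp
      have "\<not> E e x" using K4[OF cov_E[OF e(1)] _ s(1) cov_E[OF e(2)] s(2)] xu' by blast
      moreover have "e \<noteq> x" using de by auto
      ultimately have "d e x = 2" using d_eq_2I[OF cov_E[OF e(1)] s(1)] by blast
      then show False using far[OF de] cov_trans_d[OF e(2) ut] by blast
    qed
    have "d y x \<le> d y t1 + 1" "d y x \<le> d y t2 + 1"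
      using d_lip[OF sym[OF t1(1)], of y] d_lip[OF sym[OF t2(1)], of y] by blast+
    then have "d y x = Suc (d y t1)" "d y x = Suc (d y t2)"
      using no[OF t1] no[OF t2] y1 y2 by linarith+
    then have "cov y t1 x" "cov y t1 u" "cov y t2 x" "cov y t2 u"
      using t1 t2 2 by (simp_all add: cov_def)
    then show False using meet_unique[OF xt ut xu'(2)] \<open>t1 \<noteq> t2\<close> by blast
  qed
qed

text \<open>The predicate \<open>Q\<close> only constrains the neighbours of \<open>x\<close> in
  \<open>I(x,u)\<close>. On higher levels these already lie in \<open>I(x,c)\<close> for a lower
  neighbour \<open>c\<close>, so only lines through \<open>x\<close> and joins on level 2
  (\<open>atoms_subspace\<close>) need an argument. For \<open>u = y\<close> the bound is
  immediate.\<close>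

lemma hull_neighbour:
  assumes "thick x y" "w \<in> gated_hull2 E x y" "E x w"
  shows "d y w \<le> d y x"
proof -
  define Q where "Q u \<longleftrightarrow> thick x u \<and> (\<forall>t. t \<in> interval E x u \<longrightarrow> E x t \<longrightarrow> d y t \<le> d y x)" for u
  have Q_thick: "thick x u" if "Q u" for u using that by (simp add: Q_def)
  have Q_atom: "d y t \<le> d y x" if "Q u" "t \<in> interval E x u" "E x t" for u t
    using that by (simp add: Q_def)
  have self: "u \<in> interval E x u" for u by (simp add: mem_interval)
  have her: "Q u'" if "Q u" "u' \<in> interval E x u" for u u'
    unfolding Q_def
    using thick_mono[OF Q_thick[OF that(1)] that(2)] Q_atom[OF that(1)] interval_trans[OF that(2)] by blast
  have lim: "Q z" if "thick x z" "2 \<le> d x z" "\<And>c. cov x c z \<Longrightarrow> Q c" for z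
    unfolding Q_def
  proof (intro conjI allI impI that(1))
    fix t assume t: "t \<in> interval E x z" "E x t"
    then have "t \<noteq> z" using that(2) d_1[of x t] by auto
    then obtain c where "cov x c z" "t \<in> interval E x c" using lower_between[OF t(1)] by blast
    then show "d y t \<le> d y x" using Q_atom that(3) t by blast
  qed
  have Qx: "Q x"
    unfolding Q_def
  proof (intro conjI allI impI)
    show "thick x x" by (simp add: thick_le1)
    fix t assume "t \<in> interval E x x" "E x t"
    then have "d x t = 0" using d_self[of x] unfolding mem_interval by linarith
    then have "x = t" by (simp only: d_0)
    then show "d y t \<le> d y x" by simp
  qed
  have "gated E {u. Q u}"
  proof (rule ideal_gated)
    show "Q x" by (rule Qx)
    show "Q u'" if "Q u" "u' \<in> interval E x u" for u u' using her[OF that] .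
    show "Q r" if v: "Q v" "E r v" "d x r = d x v" for v r
    proof (rule same_level_induct[of Q x, OF her _ _ v])
      fix v r assume v: "Q v" "E v r" "d x v = 1" "d x r = 1"
      have Ev: "E x v" "E x r" using v(3,4) d_1 by blast+
      have le: "d y r \<le> d y x"
      proof (rule ccontr)
        assume "\<not> d y r \<le> d y x"
        then have "cov y x r" using d_lip[OF sym[OF Ev(2)], of y] Ev by (simp add: cov_def)
        then have "d y v = d y r" using line[OF _ v(2)] Ev sym by blast
        then show False using Q_atom[OF v(1) self Ev(1)] \<open>\<not> d y r \<le> d y x\<close> by simp
      qed
      show "Q r"
        unfolding Q_def
      proof (intro conjI allI impI)
        show "thick x r" using v thick_le1 by simp
        fix t assume "t \<in> interval E x r" "E x t"
        then have "d t r = 0" using v(4) d_1[of x t] unfolding mem_interval by linarith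
        then show "d y t \<le> d y x" using le by simp
      qed
    next
      fix v r assume v: "Q v" "E r v" "d x r = d x v" "2 \<le> d x r" "\<And>c. cov x c r \<Longrightarrow> Q c"
      show "Q r" using lim[OF thick_same_level[OF Q_thick[OF v(1)] v(2,3)] v(4,5)] .
    qed
    show "Q z" if "Q v" "Q w" "v \<noteq> w" "cov x v z" "cov x w z" for v w z
    proof (rule join_induct[of Q x, OF her Q_thick _ _ that])
      fix v w z assume v: "d x z = 2" "cov x v z" "cov x w z" "v \<noteq> w" "Q v" "Q w"
      have "d x v = 1" "d x w = 1" using v(1) cov_d[OF v(2)] cov_d[OF v(3)] by linarith+
      then have Ev: "E x v" "E x w" using d_1 by blast+
      show "Q z"
        unfolding Q_def
      proof (intro conjI allI impI)
        show "thick x z" using thick_join[OF Q_thick Q_thick] v by blast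
        fix t assume t: "t \<in> interval E x z" "E x t"
        then have "d t z = 1" using v(1) d_1[of x t] unfolding mem_interval by linarith
        then have "E t z" using d_1 by blast
        show "d y t \<le> d y x"
        proof (rule atoms_subspace[OF v(1) sym[OF t(2)] \<open>E t z\<close>])
          show "d y v \<le> d y x" "d y w \<le> d y x"
            using Q_atom[OF v(5) self] Q_atom[OF v(6) self] Ev by blast+
        qed (use v Ev sym cov_E in blast)+
      qed
    next
      fix v w z assume v: "3 \<le> d x z" "cov x v z" "cov x w z" "v \<noteq> w" "\<And>c. cov x c z \<Longrightarrow> Q c"
      have "thick x z" using thick_join[OF Q_thick[OF v(5)[OF v(2)]] Q_thick[OF v(5)[OF v(3)]] v(4,2,3)] .
      moreover have "2 \<le> d x z" using v(1) by linarith
      ultimately show "Q z" using lim v(5) by blast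
    qed
  qed
  moreover have "x \<in> {u. Q u}" using Qx by simp
  moreover have "Q y"
    unfolding Q_def
  proof (intro conjI allI impI assms(1))
    fix t assume "t \<in> interval E x y"
    then show "d y t \<le> d y x" using d_sym[of x y] d_sym[of t y] unfolding mem_interval by linarith
  qed
  ultimately have "Q w" using hull_subset[of "{u. Q u}" x y] assms(2) by blast
  then show ?thesis using Q_atom self assms(3) by blast
qed

section \<open>Ladders and neighbourhoods of gated sets\<close>

text \<open>Parallel geodesics: \<open>(x, x', z', z)\<close> spans a ladder of squares.\<close>
definition para :: "'a \<Rightarrow> 'a \<Rightarrow> 'a \<Rightarrow> 'a \<Rightarrow> bool" where
  "para x x' z z' \<longleftrightarrow> E x x' \<and> E z z' \<and> d x' z' = d x z \<and> d x z' = Suc (d x z) \<and> d x' z = Suc (d x z)"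

text \<open>Shortens the ladder by one rung: \<open>c\<close> is the meet of \<open>z\<close> and
  \<open>c'\<close> around \<open>x\<close>.\<close>

lemma para_down:
  assumes p: "para x x' z z'" and c': "cov x' c' z'"
  obtains c where "para x x' c c'" "cov x c z" "cov x c c'" "cov x c' z'" "cov x z z'" "z \<noteq> c'"
proof -
  have dc': "Suc (d x' c') = d x z" using c' p by (simp add: cov_def para_def)
  have "d x c' \<le> d x' c' + 1" "d x z' \<le> d x c' + 1"
    using d_lip2[of x x' c'] d_lip[OF cov_E'[OF c'], of x] p by (simp_all add: para_def)
  then have dxc': "d x c' = d x z" using dc' p by (simp add: para_def)
  have z: "cov x c' z'" "cov x z z'" using dxc' c' p by (simp_all add: cov_def para_def)
  have ne: "z \<noteq> c'" using dc' p by (auto simp: para_def)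
  obtain c where c: "cov x c z" "cov x c c'" using QC[OF z(2,1) ne] by blast
  have "d x' c \<le> d x c + 1" "d x' z \<le> d x' c + 1"
    using d_lip2[of x' x c] sym[of x x'] d_lip[OF cov_E'[OF c(1)], of x'] p by (simp_all add: para_def)
  then have "d x' c = d x z" using cov_d[OF c(1)] p by (simp add: para_def)
  then have "para x x' c c'" using c p dc' dxc' by (simp add: para_def cov_def)
  then show ?thesis using that c z ne by blast
qed

text \<open>A second middle vertex \<open>e\<close> on the side of \<open>x\<close> is carried
  across by the quadrangle condition from \<open>s'\<close>. The result differs from
  \<open>c'\<close> because \<open>z\<close> and \<open>c'\<close> have only one meet around
  \<open>x\<close>.\<close>

lemma para_thick:
  assumes "para x x' z z'" "thick x z"
  shows "thick x' z'"
  using assms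
proof (induction "d x z" arbitrary: z z' rule: less_induct)
  case less
  have self: "z \<in> interval E x z" by (simp add: mem_interval)
  show ?case
  proof (rule thick_step)
    fix c' assume "cov x' c' z'"
    then obtain c where c: "para x x' c c'" "cov x c z" using para_down[OF less(2)] by blast
    then show "thick x' c'"
      using less(1)[OF _ c(1)] thick_mono[OF less(3)] cov_interval[OF c(2)] cov_d[OF c(2)] by simp
  next
    fix s' c' assume s': "cov x' s' c'" and c': "cov x' c' z'"
    obtain c where c: "para x x' c c'" "cov x c z" "cov x c c'" "cov x c' z'" "cov x z z'" "z \<noteq> c'"
      using para_down[OF less(2) c'] by blast
    obtain s where s: "para x x' s s'" "cov x s c" using para_down[OF c(1) s'] by blast
    obtain e where e: "e \<noteq> c" "cov x s e" "cov x e z" using thick_ex[OF less(3) s(2) c(2) self] by blast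
    have ds'z': "d s' z' = 2" using cov_trans_d[OF s' c'] .
    have zz': "E z z'" using less(2) by (simp add: para_def)
    have "d s' z \<le> 3" using d_lip[OF zz', of s'] ds'z' by simp
    moreover have "d x' z \<le> d x' s' + d s' z" by (rule d_triangle)
    moreover have "d x' z = d x' s' + 3" using less(2) s' c' by (simp add: para_def cov_def)
    ultimately have ds'z: "d s' z = 3" by linarith
    have "E s' s" using s(1) sym by (auto simp: para_def)
    then have "d s' s = 1" using d_1 by blast
    then have "d s' e \<le> 2" using d_lip[OF cov_E'[OF e(2)], of s'] by simp
    moreover have "d s' z \<le> d s' e + 1" using d_lip[OF cov_E'[OF e(3)]] .
    ultimately have ds'e: "d s' e = 2" using ds'z by simp
    have "z' \<noteq> e" using e(3) c(5) by (auto simp: cov_def)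
    then obtain e' where e': "E e' z'" "E e' e" "E e' s'"
      using QC2[OF sym[OF zz'] cov_E[OF e(3)] _ ds'z' ds'e ds'z] by blast
    have "e' \<noteq> c'"
    proof
      assume "e' = c'"
      then have "cov x e c'"
        using e'(2) sym[of c' e] cov_d[OF e(3)] cov_d[OF c(2)] cov_d[OF c(3)] by (simp add: cov_def)
      then show False using meet_unique[OF c(5,4,6) c(2,3) e(3)] e(1) by blast
    qed
    then show "\<exists>e. e \<noteq> c' \<and> E e s' \<and> E e z'" using e' by blast
  qed
qed

text \<open>Around \<open>x\<close>, \<open>z'\<close> covers both \<open>z\<close> and
  \<open>c'\<close>; the latter is the far corner of a shorter ladder, so \<open>thick_join\<close>
  applies.\<close>

lemma para_thick_diag:
  assumes "para x x' z z'" "thick x z"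
  shows "thick x z'"
  using assms
proof (induction "d x z" arbitrary: z z')
  case 0
  then show ?case using thick_le1[of x z'] by (simp add: para_def)
next
  case (Suc n)
  have "d x' z' = Suc n" using Suc by (simp add: para_def)
  then obtain c' where "cov x' c' z'" using cov_ex by metis
  then obtain c where c: "para x x' c c'" "cov x c z" "cov x c' z'" "cov x z z'" "z \<noteq> c'"
    using para_down[OF Suc(3)] by metis
  have "thick x c'"
    using Suc(1)[OF _ c(1)] thick_mono[OF Suc(4)] cov_interval[OF c(2)] cov_d[OF c(2)] Suc(2) by simp
  then show ?case using thick_join[OF Suc(4) _ c(5,4,3)] by blast
qed

text \<open>The gate equations and the edge from \<open>z\<close> to \<open>v\<close> leave no slack
  in the distances. A change of gate along an edge thus becomes a ladder.\<close>

lemma gate_adjacent: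
  assumes X: "gated E X" and zv: "E z v" and ne: "gate E X v \<noteq> gate E X z"
  shows "para (gate E X v) (gate E X z) v z"
proof -
  let ?g = "gate E X z" and ?h = "gate E X v"
  have mem: "?g \<in> X" "?h \<in> X" using gate_mem[OF X] by blast+
  have "d v ?g = d v ?h + d ?h ?g" "d z ?h = d z ?g + d ?g ?h"
    using gate_d[OF X] mem by blast+
  moreover have "d v ?g \<le> d z ?g + 1" "d z ?h \<le> d v ?h + 1" using d_lip2 zv sym by blast+
  moreover have "d ?h ?g \<noteq> 0" using ne by simp
  ultimately have "d ?h ?g = 1" "d v ?h = d z ?g" "d v ?g = Suc (d v ?h)" "d z ?h = Suc (d v ?h)"
    using d_sym[of ?g ?h] by linarith+
  then show ?thesis
    unfolding para_def using zv sym d_1[of ?h ?g] d_sym[of v] d_sym[of z] by metis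
qed

lemma gate_interval:
  assumes X: "gated E X" and w: "w \<in> interval E (gate E X z) z"
  shows "gate E X w = gate E X z"
proof -
  let ?g = "gate E X z"
  have "d w ?g + d ?g y = d w y" if "y \<in> X" for y
    using gate_d[OF X that, of z] d_triangle[of z y w] d_triangle[of w y ?g] w
      d_sym[of z w] d_sym[of ?g w] d_sym[of ?g z] unfolding mem_interval by linarith
  then have "is_gate E X w ?g" using gate_mem[OF X] by (simp add: is_gate_def mem_interval)
  then show ?thesis by (rule gate_eq)
qed

lemma thick_gate:
  assumes X: "gated E X" and "u \<in> X" "thick u z"
  shows "thick (gate E X z) z"
  using thick_mono[OF thick_sym[OF assms(3)], of "gate E X z"] gate_d[OF X assms(2), of z] thick_sym
  by (simp add: mem_interval)

text \<open>The gate lies between \<open>z\<close> and any witness, so it can be the witness. For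
  closure, a neighbour with another gate is handled by \<open>para_thick\<close>; if both share the
  gate of \<open>x\<close>, \<open>thick_gated\<close> at that gate suffices.\<close>

lemma thick_nbhd_gated:
  assumes X: "gated E X"
  shows "gated E {z. \<exists>u\<in>X. thick u z}"
proof -
  have eq: "{z. \<exists>u\<in>X. thick u z} = {z. thick (gate E X z) z}"
    using thick_gate[OF X] gate_mem[OF X] by blast
  obtain p where p: "p \<in> X" using gate_mem[OF X] by blast
  have X_sub: "thick (gate E X u) u" if "u \<in> X" for u
    using gate_self[OF X that] thick_le1 by simp
  show ?thesis
    unfolding eq
  proof (rule gatedI[of p])
    show "p \<in> {z. thick (gate E X z) z}" using X_sub[OF p] by simp
    show "closed {z. thick (gate E X z) z}"
      unfolding closed_def
    proof (intro allI impI)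
      fix x v w
      assume v: "v \<in> {z. thick (gate E X z) z}" and w: "w \<in> {z. thick (gate E X z) z}"
        and ne: "v \<noteq> w" and xv: "E x v" and xw: "E x w"
      have *: "thick (gate E X x) x" if "thick (gate E X u) u" "E x u" "gate E X u \<noteq> gate E X x" for u
        using para_thick[OF gate_adjacent[OF X that(2,3)] that(1)] .
      have "thick (gate E X x) x"
      proof (cases "gate E X v = gate E X x \<and> gate E X w = gate E X x")
        case True
        then have "v \<in> {z. thick (gate E X x) z}" "w \<in> {z. thick (gate E X x) z}" using v w by auto
        then show ?thesis using closedD[OF gated_closed[OF thick_gated] _ _ ne xv xw] by blast
      next
        case False
        then show ?thesis using * v w xv xw by blast
      qed
      then show "x \<in> {z. thick (gate E X z) z}" by simp
    qed
    show "conn_in {z. thick (gate E X z) z} p z" if "z \<in> {z. thick (gate E X z) z}" for z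
    proof (rule rtranclp_trans)
      show "conn_in {z. thick (gate E X z) z} p (gate E X z)"
      proof (rule conn_interval)
        fix w assume "w \<in> interval E p (gate E X z)"
        then show "w \<in> {z. thick (gate E X z) z}"
          using X_sub[OF gated_convex[OF X p gate_mem[OF X]]] by simp
      qed
      show "conn_in {z. thick (gate E X z) z} (gate E X z) z"
      proof (rule conn_interval)
        fix w assume w: "w \<in> interval E (gate E X z) z"
        then have "thick (gate E X z) w" using thick_mono that by blast
        then show "w \<in> {z. thick (gate E X z) z}" using gate_interval[OF X w] by simp
      qed
    qed
  qed
qed

end

section \<open>Thick pairs and isometric cubes\<close>

text \<open>The walk flips, one at a time, the coordinates in which \<open>A\<close> and
  \<open>B\<close> differ.\<close>

lemma relpowp_sym_diff:
  assumes step: "\<And>C i. C \<subseteq> N \<Longrightarrow> i \<in> N \<Longrightarrow> i \<notin> C \<Longrightarrow> R (f C) (f (insert i C)) \<and> R (f (insert i C)) (f C)"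
    and "finite N" "A \<subseteq> N" "B \<subseteq> N"
  shows "(R ^^ card ((A - B) \<union> (B - A))) (f A) (f B)"
  using assms(3)
proof (induction "card ((A - B) \<union> (B - A))" arbitrary: A)
  case 0
  then have "(A - B) \<union> (B - A) = {}"
    using finite_subset[OF _ assms(2)] assms(4) by (metis card_0_eq finite_Diff finite_Un)
  then have "A = B" by blast
  then show ?case by simp
next
  case (Suc n)
  obtain i where i: "i \<in> (A - B) \<union> (B - A)" using Suc(2) by (metis card.empty equals0I nat.distinct(1))
  have iN: "i \<in> N" using i Suc assms by blast
  define A' where "A' = (if i \<in> A then A - {i} else insert i A)"
  have "(A' - B) \<union> (B - A') = ((A - B) \<union> (B - A)) - {i}" using i by (auto simp: A'_def)
  then have c: "n = card ((A' - B) \<union> (B - A'))" using i Suc(2) by simp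
  have A': "A' \<subseteq> N" using Suc(3) iN by (auto simp: A'_def)
  have "R (f A) (f A')"
  proof (cases "i \<in> A")
    case True
    then have "insert i (A - {i}) = A" by blast
    then show ?thesis using step[of "A - {i}" i] Suc(3) iN True by (auto simp: A'_def)
  next
    case False
    then show ?thesis using step[of A i] Suc(3) iN by (simp add: A'_def)
  qed
  then have "(R ^^ Suc n) (f A) (f B)" using Suc(1)[OF c A'] c by (intro relpowp_Suc_I2) auto
  then show ?case using Suc(2) by simp
qed

context swm
begin

lemma interval_sym: "z \<in> interval E x y \<longleftrightarrow> z \<in> interval E y x"
  unfolding mem_interval using d_sym[of x z] d_sym[of z y] d_sym[of x y] by linarith

text \<open>A common lower neighbour around \<open>x\<close> would complete a triangle with two
  vertices on its lower level around \<open>y\<close>, which \<open>line\<close> excludes.\<close>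

lemma interval_bipartite:
  assumes a: "a \<in> interval E x y" and b: "b \<in> interval E x y" and ab: "E a b"
  shows "d x a \<noteq> d x b"
proof
  assume eq: "d x a = d x b"
  have "d x a \<noteq> 0"
  proof
    assume "d x a = 0"
    then have "x = a" "x = b" using eq by simp_all
    then show False using ab by simp
  qed
  then obtain c where c: "cov x c a" "cov x c b" using TC[OF ab eq] by blast
  have "c \<in> interval E x y" using interval_trans[OF a cov_interval[OF c(1)]] .
  then have "d y c = Suc (d y a)" "d y a = d y b"
    using a b eq cov_d[OF c(1)] d_sym[of y] unfolding mem_interval by fastforce+
  then have "cov y a c" using cov_E'[OF c(1)] by (simp add: cov_def)
  then have "d y b = d y c" using line[OF _ cov_E'[OF c(2)] sym[OF ab]] by blast
  then show False using \<open>d y c = Suc (d y a)\<close> \<open>d y a = d y b\<close> by simp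
qed

text \<open>The common upper neighbour required by \<open>meet_unique\<close> comes from the
  quadrangle condition around \<open>y\<close>, for which \<open>a\<close> is above \<open>v\<close>
  and \<open>w\<close>.\<close>

lemma interval_meet_unique:
  assumes I: "v \<in> interval E x y" "w \<in> interval E x y" and "v \<noteq> w"
    and c: "cov x a v" "cov x a w" "cov x b v" "cov x b w"
  shows "a = b"
proof -
  have "a \<in> interval E x y" using interval_trans[OF I(1) cov_interval[OF c(1)]] .
  then have "d y a = Suc (d y v)" "d y a = Suc (d y w)"
    using I cov_d[OF c(1)] cov_d[OF c(2)] d_sym[of y] unfolding mem_interval by fastforce+
  then have "cov y v a" "cov y w a" using cov_E'[OF c(1)] cov_E'[OF c(2)] by (simp_all add: cov_def)
  then obtain t where t: "cov y t v" "cov y t w" using QC \<open>v \<noteq> w\<close> by blast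
  have "t \<in> interval E y x"
    using interval_trans[OF _ cov_interval[OF t(1)]] I(1) interval_sym by blast
  then have "d x t = Suc (d x v)" "d x v = d x w"
    using I(1) cov_d[OF t(1)] cov_d[OF c(1)] cov_d[OF c(2)]
      d_sym[of y x] d_sym[of y v] d_sym[of x t] unfolding mem_interval by linarith+
  then have "cov x v t" "cov x w t" using cov_E'[OF t(1)] cov_E'[OF t(2)] by (simp_all add: cov_def)
  then show ?thesis using meet_unique[OF _ _ \<open>v \<noteq> w\<close> c(1,2,3,4)] by blast
qed

lemma relpowp_interval:
  assumes "u \<in> interval E x y" "v \<in> interval E x y"
  obtains n where "((\<lambda>a b. E a b \<and> b \<in> interval E x y) ^^ n) u v"
proof -
  have *: "conn_in (interval E x y) x z" if "z \<in> interval E x y" for z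
    using conn_interval[OF interval_trans[OF that]] .
  have "conn_in (interval E x y) u v"
    by (rule rtranclp_trans[OF conn_in_sym[OF *[OF assms(1)]] *[OF assms(2)]])
  then have "(\<lambda>a b. E a b \<and> b \<in> interval E x y)\<^sup>*\<^sup>* u v"
    by (rule rtranclp_mono[THEN predicate2D, rotated]) blast
  then show ?thesis using that unfolding rtranclp_power by blast
qed

text \<open>By minimality of \<open>d x (g {})\<close>, the levels of the vertices of the cube increase with the
  cardinality, so the extreme vertices are \<open>x\<close> and \<open>y\<close>.\<close>
lemma cube_thick:
  assumes I: "\<And>S. S \<subseteq> {..<d x y} \<Longrightarrow> g S \<in> interval E x y"
    and edge: "\<And>S i. insert i S \<subseteq> {..<d x y} \<Longrightarrow> i \<notin> S \<Longrightarrow> E (g S) (g (insert i S))"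
    and dist: "\<And>S i j. insert i (insert j S) \<subseteq> {..<d x y} \<Longrightarrow> i \<notin> S \<Longrightarrow> j \<notin> S \<Longrightarrow> i \<noteq> j \<Longrightarrow>
      g S \<noteq> g (insert i (insert j S)) \<and> g (insert i S) \<noteq> g (insert j S)"
    and min: "\<And>S. S \<subseteq> {..<d x y} \<Longrightarrow> d x (g {}) \<le> d x (g S)"
  shows "thick x y"
proof -
  let ?N = "{..<d x y}"
  have fin: "finite S" if "S \<subseteq> ?N" for S using that finite_subset by blast
  have level: "d x (g S) = d x (g {}) + card S" if "S \<subseteq> ?N" for S
    using that
  proof (induction "card S" arbitrary: S rule: less_induct)
    case less
    note S = less(2)
    show ?case
    proof (cases "S = {}")
      case False
      then obtain i T where T: "S = insert i T" "i \<notin> T" by (meson Set.set_insert ex_in_conv)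
      have TN: "T \<subseteq> ?N" and cT: "card S = Suc (card T)" using S T fin[of T] by auto
      have dT: "d x (g T) = d x (g {}) + card T" using less(1)[OF _ TN] cT by simp
      have e: "E (g T) (g S)" using edge[of i T] S T by simp
      have ne: "d x (g T) \<noteq> d x (g S)" using interval_bipartite[OF I[OF TN] I[OF S] e] .
      have up: "d x (g S) \<le> d x (g T) + 1" using d_lip[OF sym[OF e]] .
      have "d x (g T) \<le> d x (g S)"
      proof (cases "T = {}")
        case True
        then show ?thesis using min[OF S] by simp
      next
        case False
        then obtain j U where U: "T = insert j U" "j \<notin> U" by (meson Set.set_insert ex_in_conv)
        have "i \<noteq> j" "i \<notin> U" using T U by auto
        have UN: "U \<subseteq> ?N" "insert i U \<subseteq> ?N" and cU: "card T = Suc (card U)"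
          "card (insert i U) = Suc (card U)"
          using S T U TN fin[of U] \<open>i \<notin> U\<close> by auto
        have dU: "d x (g U) = d x (g {}) + card U" using less(1)[OF _ UN(1)] cU cT by simp
        have dV: "d x (g (insert i U)) = d x (g T)" using less(1)[OF _ UN(2)] cU cT dT by simp
        show ?thesis
        proof (rule ccontr)
          assume "\<not> d x (g T) \<le> d x (g S)"
          then have dS: "d x (g T) = Suc (d x (g S))" using d_lip[OF e, of x] by linarith
          \<comment> \<open>A step down would give \<open>g T\<close> and
            \<open>g (insert i U)\<close> two distinct meets, \<open>g S\<close> and
            \<open>g U\<close>.\<close>
          have "E (g (insert i U)) (g S)"
            using edge[of j "insert i U"] S T U \<open>i \<noteq> j\<close> by (simp add: insert_commute)
          moreover have "E (g U) (g T)" "E (g U) (g (insert i U))"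
            using edge[of j U] edge[of i U] U TN UN \<open>i \<notin> U\<close> by simp_all
          ultimately have "cov x (g S) (g T)" "cov x (g S) (g (insert i U))"
            "cov x (g U) (g T)" "cov x (g U) (g (insert i U))"
            using e sym dS dV dU dT cU by (simp_all add: cov_def)
          moreover have ds: "g U \<noteq> g S" "g (insert i U) \<noteq> g T"
            using dist[of i j U] S T U \<open>i \<noteq> j\<close> \<open>i \<notin> U\<close> by auto
          ultimately show False using interval_meet_unique[OF I[OF TN] I[OF UN(2)]] by metis
        qed
      qed
      then show ?thesis using ne up dT cT by linarith
    qed simp
  qed
  \<comment> \<open>The top of the cube is \<open>d x y\<close> levels above its bottom and still in
    the interval, so the bottom has level 0.\<close>
  have "d x (g ?N) \<le> d x y" using I[of ?N] by (simp add: mem_interval)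
  then have "d x (g {}) = 0" using level[of ?N] by simp
  then have g0: "g {} = x" by simp
  have "d x (g ?N) = d x y" using level[of ?N] \<open>d x (g {}) = 0\<close> by simp
  then have "d (g ?N) y = 0" using I[of ?N] unfolding mem_interval by simp
  then have gN: "g ?N = y" by simp
  have "thick x (g S)" if "S \<subseteq> ?N" for S
    using that
  proof (induction "card S" arbitrary: S rule: less_induct)
    case less
    note S = less(2)
    show ?case
    proof (cases "card S \<le> 1")
      case True
      then show ?thesis using thick_le1 level[OF S] \<open>d x (g {}) = 0\<close> by simp
    next
      case False
      then obtain i T where T: "S = insert i T" "i \<notin> T"
        by (metis card.empty Set.set_insert ex_in_conv le0)
      have cT: "card S = Suc (card T)" using S T fin[of T] by auto
      then have "T \<noteq> {}" using False by auto
      then obtain j U where U: "T = insert j U" "j \<notin> U" by (meson Set.set_insert ex_in_conv)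
      have ij: "i \<noteq> j" "i \<notin> U" using T U by auto
      have N: "T \<subseteq> ?N" "insert i U \<subseteq> ?N" using S T U by auto
      have cU: "card (insert i U) = card T" using U ij S T fin[of U] by auto
      have "E (g T) (g S)" "E (g (insert i U)) (g S)"
        using edge[of i T] edge[of j "insert i U"] S T U ij by (simp_all add: insert_commute)
      then have c: "cov x (g T) (g S)" "cov x (g (insert i U)) (g S)"
        using level[OF S] level[OF N(1)] level[OF N(2)] cT cU by (simp_all add: cov_def)
      have "g (insert i U) \<noteq> g T" using dist[of i j U] S T U ij by auto
      then show ?thesis
        using thick_join[OF less(1)[OF _ N(2)] less(1)[OF _ N(1)] _ c(2,1)] cT cU by simp
    qed
  qed
  then show ?thesis using gN by force
qed

lemma boolean_pair_thick:
  assumes "boolean_pair E x y"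
  shows "thick x y"
proof -
  let ?N = "{..<d x y}" and ?I = "interval E x y"
  obtain f where fI: "\<And>A. A \<subseteq> ?N \<Longrightarrow> f A \<in> ?I"
    and fd: "\<And>A B. A \<subseteq> ?N \<Longrightarrow> B \<subseteq> ?N \<Longrightarrow> dist_in E ?I (f A) (f B) = card ((A - B) \<union> (B - A))"
    using assms unfolding boolean_pair_def by blast
  obtain A0 where A0: "A0 \<subseteq> ?N" and min: "\<And>A. A \<subseteq> ?N \<Longrightarrow> d x (f A0) \<le> d x (f A)"
    using ex_has_least_nat[of "\<lambda>A. A \<subseteq> ?N" ?N "\<lambda>A. d x (f A)"] by auto
  \<comment> \<open>A reflection of the cube that gives its lowest vertex \<open>f A0\<close> the
    index \<open>{}\<close>.\<close>
  define g where "g S = f ((A0 - S) \<union> (S - A0))" for S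
  have sub: "(A0 - S) \<union> (S - A0) \<subseteq> ?N" if "S \<subseteq> ?N" for S using A0 that by blast
  have gd: "dist_in E ?I (g S) (g T) = card ((S - T) \<union> (T - S))" if "S \<subseteq> ?N" "T \<subseteq> ?N" for S T
  proof -
    have "(((A0 - S) \<union> (S - A0)) - ((A0 - T) \<union> (T - A0))) \<union> (((A0 - T) \<union> (T - A0)) - ((A0 - S) \<union> (S - A0)))
      = (S - T) \<union> (T - S)" by blast
    then show ?thesis using fd[OF sub[OF that(1)] sub[OF that(2)]] by (simp add: g_def)
  qed
  have gI: "g S \<in> ?I" if "S \<subseteq> ?N" for S using fI[OF sub[OF that]] by (simp add: g_def)
  have E1: "E (g S) (g T)" if ST: "S \<subseteq> ?N" "T \<subseteq> ?N" "(S - T) \<union> (T - S) = {i}" for S T i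
  proof -
    \<comment> \<open>Only once some walk inside the interval exists does the value of
      \<open>dist_in\<close> yield an edge.\<close>
    obtain n where n: "((\<lambda>a b. E a b \<and> b \<in> ?I) ^^ n) (g S) (g T)"
      using relpowp_interval[OF gI[OF ST(1)] gI[OF ST(2)]] by blast
    have "dist_in E ?I (g S) (g T) = Suc 0" using gd[OF that(1,2)] that(3) by simp
    then show ?thesis using relpowp_dist_in[OF gI[OF that(1)] n] by auto
  qed
  have ne: "g S \<noteq> g T" if "S \<subseteq> ?N" "T \<subseteq> ?N" "i \<in> (S - T) \<union> (T - S)" for S T i
  proof
    assume "g S = g T"
    then have "dist_in E ?I (g S) (g T) \<le> 0" using dist_in_le[OF gI[OF that(1)], where n = 0] by simp
    moreover have "finite ((S - T) \<union> (T - S))" using that finite_subset[of _ ?N] by blast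
    ultimately show False using gd[OF that(1,2)] that(3) by auto
  qed
  show ?thesis
  proof (rule cube_thick[of x y g, OF gI])
    show "E (g S) (g (insert i S))" if "insert i S \<subseteq> ?N" "i \<notin> S" for S i
      by (rule E1[of _ _ i]) (use that in auto)
    show "g S \<noteq> g (insert i (insert j S)) \<and> g (insert i S) \<noteq> g (insert j S)"
      if "insert i (insert j S) \<subseteq> ?N" "i \<notin> S" "j \<notin> S" "i \<noteq> j" for S i j
      using ne[of S "insert i (insert j S)" i] ne[of "insert i S" "insert j S" i] that by blast
    show "d x (g {}) \<le> d x (g S)" if "S \<subseteq> ?N" for S
      using min[OF sub[OF that]] by (simp add: g_def)
  qed
qed

text \<open>The atom is the new coordinate direction of the larger cube. It is inherited from the
  parallel step from \<open>s\<close> to \<open>y2\<close>: were it in \<open>I(x,y')\<close>, the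
  meet of \<open>y'\<close> and \<open>y2\<close> around \<open>t\<close> would be \<open>s\<close>,
  and \<open>t\<close> would lie in \<open>I(x,s)\<close>.\<close>

lemma new_atom:
  assumes "thick x y" "cov x y' y"
  obtains t where "E x t" "t \<in> interval E x y" "t \<notin> interval E x y'"
proof -
  have "\<exists>t. E x t \<and> t \<in> interval E x y \<and> t \<notin> interval E x y'"
    using assms
  proof (induction "d x y" arbitrary: y y' rule: less_induct)
    case less
    have dy: "d x y = Suc (d x y')" using cov_d[OF less(3)] .
    show ?case
    proof (cases "d x y'")
      case 0
      then have "x = y'" by simp
      then show ?thesis using cov_E[OF less(3)] dy by (intro exI[of _ y]) (auto simp: mem_interval)
    next
      case (Suc k)
      then obtain s where s: "cov x s y'" using cov_ex by metis
      have "y \<in> interval E x y" by (simp add: mem_interval)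
      then obtain y2 where y2: "y2 \<noteq> y'" "cov x s y2" "cov x y2 y"
        using thick_ex[OF less(2) s less(3)] by blast
      have "thick x y2" using thick_mono[OF less(2) cov_interval[OF y2(3)]] .
      then obtain t where t: "E x t" "t \<in> interval E x y2" "t \<notin> interval E x s"
        using less(1)[OF _ _ y2(2)] cov_d[OF y2(3)] by auto
      have "t \<in> interval E x y" using interval_trans[OF cov_interval[OF y2(3)] t(2)] .
      moreover have "t \<notin> interval E x y'"
      proof
        assume "t \<in> interval E x y'"
        moreover have "d x t = 1" using t(1) d_1 by blast
        ultimately have d: "1 + d t y' = d x y'" "1 + d t y2 = d x y2" "1 + d t y = d x y"
          using t(2) \<open>t \<in> interval E x y\<close> by (simp_all add: mem_interval)
        then have "cov t y' y" "cov t y2 y"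
          using cov_d[OF y2(3)] dy cov_E[OF y2(3)] cov_E[OF less(3)] by (simp_all add: cov_def)
        then obtain m where m: "cov t m y'" "cov t m y2" using QC y2(1) by metis
        have "d x m \<le> 1 + d t m" using d_triangle[of x m t] \<open>d x t = 1\<close> by simp
        moreover have "d x y' \<le> d x m + 1" using d_lip[OF cov_E'[OF m(1)]] .
        ultimately have "d x y' = Suc (d x m)" "d x m = 1 + d t m" using d cov_d[OF m(1)] by linarith+
        moreover have "d x y2 = d x y'" using cov_d[OF s] cov_d[OF y2(2)] by simp
        ultimately have "cov x m y'" "cov x m y2" using m cov_E by (simp_all add: cov_def)
        then have "m = s" using meet_unique[OF less(3) y2(3) _ _ _ s y2(2)] y2(1) by blast
        then show False using t(3) \<open>d x m = 1 + d t m\<close> \<open>d x t = 1\<close> by (simp add: mem_interval)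
      qed
      ultimately show ?thesis using t(1) by blast
    qed
  qed
  then show ?thesis using that by blast
qed

text \<open>The gate map from \<open>I(x,y')\<close> to the hull of \<open>t\<close> and \<open>y\<close>, where \<open>t\<close> is an atom of \<open>I(x,y)\<close>
  outside \<open>I(x,y')\<close>, is the translation that doubles a cube of \<open>I(x,y')\<close>.\<close>
lemma translation:
  assumes xy: "thick x y" and y': "cov x y' y"
  obtains \<phi> where "\<And>u. u \<in> interval E x y' \<Longrightarrow> \<phi> u \<in> interval E x y"
    and "\<And>u w. u \<in> interval E x y' \<Longrightarrow> w \<in> interval E x y' \<Longrightarrow> d (\<phi> u) w = Suc (d u w)"
    and "\<And>u w. u \<in> interval E x y' \<Longrightarrow> w \<in> interval E x y' \<Longrightarrow> d (\<phi> u) (\<phi> w) = d u w"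
proof -
  obtain t where t: "E x t" "t \<in> interval E x y" "t \<notin> interval E x y'" using new_atom[OF assms] .
  have dxt: "d x t = 1" using t(1) d_1 by blast
  define X where "X = gated_hull2 E x y'"
  define X' where "X' = gated_hull2 E y t"
  have X: "gated E X" "gated E X'" unfolding X_def X'_def by (rule gated_hull)+
  have mem: "x \<in> X" "t \<in> X'" "y \<in> X'" unfolding X_def X'_def by (rule hull_left hull_right)+
  have I: "u \<in> interval E x y" if "u \<in> interval E x y'" for u
    using interval_trans[OF cov_interval[OF y'] that] .
  have IX: "u \<in> X" if "u \<in> interval E x y'" for u unfolding X_def using interval_hull[OF that] .
  \<comment> \<open>Equal distances would, by the triangle condition from \<open>u\<close>, give an
    edge between two vertices of level 1 in \<open>I(x,y)\<close>.\<close>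
  have dtu: "d t u = Suc (d x u)" if u: "u \<in> interval E x y'" for u
  proof -
    have "d t u \<le> d x u + 1" "d x u \<le> d t u + 1" using d_lip2 t(1) sym by blast+
    moreover have "d x u \<noteq> d t u + 1"
    proof
      assume "d x u = d t u + 1"
      then have "t \<in> interval E x u" using dxt by (simp add: mem_interval)
      then show False using interval_trans[OF u] t(3) by blast
    qed
    moreover have "d x u \<noteq> d t u"
    proof
      assume "d x u = d t u"
      then have eq: "d u x = d u t" using d_sym[of u] by simp
      have "d u x \<noteq> 0"
      proof
        assume "d u x = 0"
        then have "u = x" "u = t" using eq by simp_all
        then show False using t(1) by simp
      qed
      then obtain e where e: "cov u e x" "cov u e t" using TC[OF t(1) eq] by blast
      have "e \<in> interval E x u" using cov_interval[OF e(1)] interval_sym by blast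
      then have "e \<in> interval E x y" using interval_trans[OF I[OF u]] by blast
      moreover have "d x e = d x t" using dxt cov_E'[OF e(1)] d_1 by metis
      ultimately show False using interval_bipartite[OF _ t(2) cov_E[OF e(2)]] by blast
    qed
    ultimately show ?thesis by linarith
  qed
  \<comment> \<open>Being outside \<open>I(x,y')\<close> does not yet exclude \<open>t\<close> from
    the hull; \<open>hull_neighbour\<close> does, as \<open>t\<close> is farther from
    \<open>y'\<close> than \<open>x\<close> is.\<close>
  have tX: "t \<notin> X"
  proof
    assume "t \<in> X"
    then have "d y' t \<le> d y' x"
      using hull_neighbour[OF thick_mono[OF xy cov_interval[OF y']] _ t(1)] by (simp add: X_def)
    moreover have "y' \<in> interval E x y'" by (simp add: mem_interval)
    ultimately show False using dtu[of y'] d_sym[of y'] by simp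
  qed
  have xX': "x \<notin> X'"
  proof
    assume "x \<in> X'"
    moreover have "thick y t" using thick_mono[OF thick_sym[OF xy]] t(2) interval_sym by blast
    ultimately have "d y x \<le> d y t"
      using hull_neighbour[of t y x] thick_sym sym[OF t(1)] by (simp add: X'_def hull_sym)
    then show False using t(2) dxt d_sym[of y] by (simp add: mem_interval)
  qed
  let ?p = "gate E X'"
  have pX': "?p u \<in> X'" for u using gate_mem[OF X(2)] .
  have main: "?p u \<in> interval E x y \<and> E u (?p u) \<and> ?p u \<notin> X" if u: "u \<in> interval E x y'" for u
  proof -
    have g: "d u t = d u (?p u) + d (?p u) t" "d u y = d u (?p u) + d (?p u) y"
      using gate_d[OF X(2)] mem by blast+
    have y: "d x u + d u y = d x y" "1 + d t y = d x y" using I[OF u] t(2) dxt by (simp_all add: mem_interval)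
    have "d t y \<le> d t (?p u) + d (?p u) y" by (rule d_triangle)
    then have le: "d u (?p u) \<le> 1" using g y dtu[OF u] d_sym[of t u] d_sym[of t "?p u"] by linarith
    have "d u (?p u) \<noteq> 0"
    proof
      assume "d u (?p u) = 0"
      then have "u \<in> X'" using pX'[of u] by simp
      moreover have "x \<in> interval E u t" using dtu[OF u] dxt d_sym[of u] by (simp add: mem_interval)
      ultimately show False using gated_convex[OF X(2) _ mem(2)] xX' by blast
    qed
    then have 1: "d u (?p u) = 1" using le by linarith
    then have Eu: "E u (?p u)" using d_1 by blast
    have "d x (?p u) \<le> d x u + 1" using d_lip[OF sym[OF Eu]] .
    moreover have "d x y \<le> d x (?p u) + d (?p u) y" by (rule d_triangle)
    ultimately have dp: "d x (?p u) = Suc (d x u)" "d x (?p u) + d (?p u) y = d x y"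
      using g y 1 by linarith+
    have "?p u \<notin> X"
    proof
      assume "?p u \<in> X"
      moreover have "t \<in> interval E x (?p u)"
        using dxt g(1) dtu[OF u] d_sym[of t u] d_sym[of t "?p u"] dp(1) 1 by (simp add: mem_interval)
      ultimately show False using gated_convex[OF X(1) mem(1)] tX by blast
    qed
    then show ?thesis using Eu dp(2) by (simp add: mem_interval)
  qed
  \<comment> \<open>\<open>u\<close> is in turn the gate of \<open>?p u\<close> in \<open>X\<close>,
    so distances from \<open>?p u\<close> into \<open>X\<close> pass through \<open>u\<close>.
    \<open>d2\<close> uses the gates in the opposite direction.\<close>
  have d1: "d (?p u) w = Suc (d u w)" if u: "u \<in> interval E x y'" and w: "w \<in> interval E x y'" for u w
  proof -
    have E': "E (?p u) u" using main[OF u] sym by blast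
    then have "gate E X (?p u) = u" using gate_eqI[OF X(1)] main[OF u] IX[OF u] by blast
    then have "d (?p u) w = d (?p u) u + d u w" using gate_d[OF X(1) IX[OF w], of "?p u"] by simp
    moreover have "d (?p u) u = 1" using E' d_1 by blast
    ultimately show ?thesis by simp
  qed
  have d2: "d (?p u) (?p w) = d u w" if u: "u \<in> interval E x y'" and w: "w \<in> interval E x y'" for u w
  proof -
    have "d u (?p w) = d u (?p u) + d (?p u) (?p w)" using gate_d[OF X(2) pX'] .
    moreover have "d u (?p u) = 1" using main[OF u] d_1 by blast
    moreover have "d u (?p w) = Suc (d u w)" using d1[OF w u] d_sym[of u] by simp
    ultimately show ?thesis by simp
  qed
  show ?thesis by (rule that[of ?p, OF _ d1 d2]) (use main in blast)
qed

lemma thick_cube: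
  assumes "thick x y"
  shows "\<exists>f. (\<forall>A. A \<subseteq> {..<d x y} \<longrightarrow> f A \<in> interval E x y) \<and>
    (\<forall>A B. A \<subseteq> {..<d x y} \<longrightarrow> B \<subseteq> {..<d x y} \<longrightarrow> d (f A) (f B) = card ((A - B) \<union> (B - A)))"
  using assms
proof (induction "d x y" arbitrary: y)
  case 0
  then have "x = y" by simp
  then show ?case by (intro exI[of _ "\<lambda>_. x"]) (auto simp: mem_interval)
next
  case (Suc m)
  obtain y' where y': "cov x y' y" "d x y' = m" using cov_ex Suc(2) by metis
  let ?I = "interval E x y'" and ?M = "{..<m}"
  have "thick x y'" using thick_mono[OF Suc(3) cov_interval[OF y'(1)]] .
  then obtain h where hI: "\<And>A. A \<subseteq> ?M \<Longrightarrow> h A \<in> ?I"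
    and hd: "\<And>A B. A \<subseteq> ?M \<Longrightarrow> B \<subseteq> ?M \<Longrightarrow> d (h A) (h B) = card ((A - B) \<union> (B - A))"
    using Suc(1)[of y'] y'(2) by blast
  obtain \<phi> where p: "\<And>u. u \<in> ?I \<Longrightarrow> \<phi> u \<in> interval E x y"
    and p1: "\<And>u w. u \<in> ?I \<Longrightarrow> w \<in> ?I \<Longrightarrow> d (\<phi> u) w = Suc (d u w)"
    and p2: "\<And>u w. u \<in> ?I \<Longrightarrow> w \<in> ?I \<Longrightarrow> d (\<phi> u) (\<phi> w) = d u w"
    using translation[OF Suc(3) y'(1)] by blast
  \<comment> \<open>Coordinate \<open>m\<close> records whether a vertex of the smaller cube is
    translated.\<close>
  define f where "f A = (if m \<in> A then \<phi> (h (A - {m})) else h A)" for A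
  have sub: "A - {m} \<subseteq> ?M" if "A \<subseteq> {..<Suc m}" for A using that by (auto simp: less_Suc_eq)
  have sub': "A \<subseteq> ?M" if "A \<subseteq> {..<Suc m}" "m \<notin> A" for A using that by (auto simp: less_Suc_eq)
  have "f A \<in> interval E x y" if "A \<subseteq> {..<Suc m}" for A
    using p[OF hI[OF sub[OF that]]] interval_trans[OF cov_interval[OF y'(1)] hI[OF sub'[OF that]]]
    by (simp add: f_def)
  moreover have mixed: "d (\<phi> (h (A - {m}))) (h B) = card ((A - B) \<union> (B - A))"
    if A: "A \<subseteq> {..<Suc m}" "m \<in> A" and B: "B \<subseteq> {..<Suc m}" "m \<notin> B" for A B
  proof -
    have fin: "finite A" "finite B" using A B finite_subset by blast+
    have "(A - B) \<union> (B - A) = insert m (((A - {m}) - B) \<union> (B - (A - {m})))" using A B by blast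
    then have "card ((A - B) \<union> (B - A)) = Suc (card (((A - {m}) - B) \<union> (B - (A - {m}))))"
      using fin B by simp
    then show ?thesis
      using p1[OF hI[OF sub[OF A(1)]] hI[OF sub'[OF B]]] hd[OF sub[OF A(1)] sub'[OF B]] by simp
  qed
  have "d (f A) (f B) = card ((A - B) \<union> (B - A))" if A: "A \<subseteq> {..<Suc m}" and B: "B \<subseteq> {..<Suc m}" for A B
  proof (cases "m \<in> A"; cases "m \<in> B")
    assume m: "m \<in> A" "m \<in> B"
    have "((A - {m}) - (B - {m})) \<union> ((B - {m}) - (A - {m})) = (A - B) \<union> (B - A)" using m by blast
    then show ?thesis
      using m p2[OF hI[OF sub[OF A]] hI[OF sub[OF B]]] hd[OF sub[OF A] sub[OF B]] by (simp add: f_def)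
  next
    assume "m \<in> A" "m \<notin> B"
    then show ?thesis using mixed[OF A _ B] by (simp add: f_def)
  next
    assume "m \<notin> A" "m \<in> B"
    then show ?thesis using mixed[OF B _ A] d_sym[of "h A"] by (simp add: f_def Un_commute)
  next
    assume "m \<notin> A" "m \<notin> B"
    then show ?thesis using hd[OF sub'[OF A] sub'[OF B]] by (simp add: f_def)
  qed
  ultimately show ?case using Suc(2) by (intro exI[of _ f]) simp
qed

text \<open>\<open>boolean_pair\<close> measures distances inside the interval. On the cube they
  agree with \<open>d\<close>, since the coordinate-flipping walk stays inside and is as short as
  \<open>d\<close> allows.\<close>

lemma thick_boolean_pair:
  assumes "thick x y"
  shows "boolean_pair E x y"
proof -
  let ?N = "{..<d x y}" and ?I = "interval E x y"
  obtain f where fI: "\<And>A. A \<subseteq> ?N \<Longrightarrow> f A \<in> ?I"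
    and fd: "\<And>A B. A \<subseteq> ?N \<Longrightarrow> B \<subseteq> ?N \<Longrightarrow> d (f A) (f B) = card ((A - B) \<union> (B - A))"
    using thick_cube[OF assms] by blast
  have E: "E (f C) (f (insert i C))" if "C \<subseteq> ?N" "i \<in> ?N" "i \<notin> C" for C i
  proof -
    have "(C - insert i C) \<union> (insert i C - C) = {i}" using that by blast
    then have "d (f C) (f (insert i C)) = 1" using fd[of C "insert i C"] that by simp
    then show ?thesis using d_1 by blast
  qed
  have "dist_in E ?I (f A) (f B) = card ((A - B) \<union> (B - A))" if "A \<subseteq> ?N" "B \<subseteq> ?N" for A B
  proof -
    let ?n = "card ((A - B) \<union> (B - A))"
    have "((\<lambda>a b. E a b \<and> b \<in> ?I) ^^ ?n) (f A) (f B)"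
      by (rule relpowp_sym_diff[of ?N]) (use E sym fI that in auto)
    then show ?thesis
      using dist_in_le[OF fI[OF that(1)]] dist_in_ge[OF fI[OF that(1)]] fd[OF that] by fastforce
  qed
  then show ?thesis unfolding boolean_pair_def using fI by blast
qed

lemma delta_edge_iff: "delta_edge E u v \<longleftrightarrow> u \<noteq> v \<and> thick u v"
proof
  assume "delta_edge E u v"
  then consider "E u v" | "2 \<le> d u v" "boolean_pair E u v" by (auto simp: delta_edge_def)
  then show "u \<noteq> v \<and> thick u v"
  proof cases
    case 1
    then have "d u v = 1" using d_1 by blast
    then show ?thesis using thick_le1[of u v] by auto
  next
    case 2
    then show ?thesis using boolean_pair_thick by auto
  qed
next
  assume uv: "u \<noteq> v \<and> thick u v"
  then have "d u v \<noteq> 0" by simp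
  then consider "d u v = 1" | "2 \<le> d u v" by linarith
  then show "delta_edge E u v"
    using thick_boolean_pair uv d_1 unfolding delta_edge_def by cases blast+
qed

section \<open>Boolean-gated sets\<close>

lemma boolean_gated_thick:
  assumes B: "boolean_gated E B" and u: "u \<in> B" and v: "v \<in> B"
  shows "thick u v"
  unfolding thick_def
proof (intro allI impI)
  fix a c assume ac: "d a c = 2 \<and> d u a + 2 + d c v = d u v"
  have gB: "gated E B" using B by (simp add: boolean_gated_def)
  have dist: "dist_in E B r s = d r s" if "r \<in> B" "s \<in> B" for r s
    by (rule dist_in_convex[OF gated_convex[OF gB] that])
  have "a \<in> interval E u v" "c \<in> interval E u v"
    using ac d_triangle[of a v c] d_triangle[of u v a] d_triangle[of u c a] d_triangle[of u v c]
    unfolding mem_interval by linarith+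
  then have mem: "a \<in> B" "c \<in> B" using gated_convex[OF gB u v] by blast+
  then have "dist_in E B a c = 2" using dist ac by simp
  moreover have "thick_set E B" using B by (simp add: boolean_gated_def)
  ultimately have "\<exists>e1 e2 e3 e4. {e1, e2, e3, e4} \<subseteq>
      {x \<in> B. dist_in E B a x + dist_in E B x c = dist_in E B a c} \<and> induced_C4 E e1 e2 e3 e4"
    using mem unfolding thick_set_def by blast
  then obtain e1 e2 e3 e4 where C: "{e1, e2, e3, e4} \<subseteq> {x \<in> B. dist_in E B a x + dist_in E B x c = 2}"
    "induced_C4 E e1 e2 e3 e4"
    unfolding \<open>dist_in E B a c = 2\<close> by blast
  \<comment> \<open>Each vertex of the 4-cycle is \<open>a\<close>, \<open>c\<close> or a common
    neighbour of both; as the four are distinct, at least two are common neighbours.\<close>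
  have *: "x = a \<or> x = c \<or> E x a \<and> E x c" if "x \<in> {e1, e2, e3, e4}" for x
  proof -
    have "d a x + d x c = 2" using subsetD[OF C(1) that] dist mem by auto
    then consider "d a x = 0" | "d x c = 0" | "d a x = 1" "d x c = 1" by linarith
    then show ?thesis
    proof cases
      case 3
      then show ?thesis using d_1 sym by blast
    qed simp_all
  qed
  have "distinct [e1, e2, e3, e4]" using C(2) by (simp add: induced_C4_def)
  moreover have "e1 = a \<or> e1 = c \<or> E e1 a \<and> E e1 c" "e2 = a \<or> e2 = c \<or> E e2 a \<and> E e2 c"
    "e3 = a \<or> e3 = c \<or> E e3 a \<and> E e3 c" "e4 = a \<or> e4 = c \<or> E e4 a \<and> E e4 c"
    using * by blast+
  ultimately show "\<exists>b b'. b \<noteq> b' \<and> E b a \<and> E b c \<and> E b' a \<and> E b' c" by force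
qed

lemma hull_boolean_gated:
  assumes xy: "thick x y"
  shows "boolean_gated E (gated_hull2 E x y)"
  unfolding boolean_gated_def thick_set_def
proof (intro conjI ballI impI)
  let ?H = "gated_hull2 E x y"
  show gH: "gated E ?H" by (rule gated_hull)
  have dist: "dist_in E ?H r s = d r s" if "r \<in> ?H" "s \<in> ?H" for r s
    by (rule dist_in_convex[OF gated_convex[OF gH] that])
  fix u v assume uv: "u \<in> ?H" "v \<in> ?H" "dist_in E ?H u v = 2"
  then have d2: "d u v = 2" using dist by simp
  then have nuv: "\<not> E u v" "u \<noteq> v" using d_1[of u v] by auto
  have "d u v = 2 \<and> d u u + 2 + d v v = d u v" using d2 by simp
  then obtain a b where ab: "a \<noteq> b" "E a u" "E a v" "E b u" "E b v"
    using thick_hull[OF xy uv(1,2)] unfolding thick_def by blast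
  have I: "c \<in> ?H" "d u c + d c v = 2" if "E c u" "E c v" for c
  proof -
    have "d u c = 1" "d c v = 1" using that sym d_1 by blast+
    then show "d u c + d c v = 2" by simp
    then show "c \<in> ?H" using gated_convex[OF gH uv(1,2)] d2 by (simp add: mem_interval)
  qed
  have "\<not> E a b" using K4[of a b u v] ab nuv by blast
  then have "induced_C4 E u a v b"
    unfolding induced_C4_def using ab nuv sym by auto
  moreover have "{u, a, v, b} \<subseteq> {x \<in> ?H. dist_in E ?H u x + dist_in E ?H x v = dist_in E ?H u v}"
    using I[OF ab(2,3)] I[OF ab(4,5)] uv(1,2) d2 by (simp add: dist)
  ultimately show "\<exists>a b c e. {a, b, c, e} \<subseteq>
      {x \<in> ?H. dist_in E ?H u x + dist_in E ?H x v = dist_in E ?H u v} \<and> induced_C4 E a b c e"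
    by blast
qed

text \<open>If the gates differ or \<open>w\<close> lies above \<open>x\<close>, the hull of
  \<open>gate E X x\<close> and \<open>w\<close> serves; different gates give a ladder, whose
  diagonal is thick. Otherwise \<open>w\<close> is already in the hull of \<open>gate E X x\<close>
  and \<open>x\<close>.\<close>

lemma boolean_gated_extend:
  assumes X: "gated E X" and x: "thick (gate E X x) x" and w: "thick (gate E X w) w" and xw: "E x w"
  obtains B where "boolean_gated E B" "gated_hull2 E (gate E X x) x \<subseteq> B" "w \<in> B"
proof -
  let ?g = "gate E X x"
  have up: "\<exists>B. boolean_gated E B \<and> gated_hull2 E ?g x \<subseteq> B \<and> w \<in> B"
    if gw: "thick ?g w" and c: "cov ?g x w"
    using hull_boolean_gated[OF gw] hull_right[of w ?g]
      hull_subset[OF gated_hull hull_left interval_hull[OF cov_interval[OF c]]] by blast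
  have below: "\<exists>B. boolean_gated E B \<and> gated_hull2 E ?g x \<subseteq> B \<and> w \<in> B"
    if "w \<in> gated_hull2 E ?g x"
    using hull_boolean_gated[OF x] that by blast
  have "\<exists>B. boolean_gated E B \<and> gated_hull2 E ?g x \<subseteq> B \<and> w \<in> B"
  proof (cases "gate E X w = ?g")
    case True
    consider "d ?g w = Suc (d ?g x)" | "d ?g x = Suc (d ?g w)" | "d ?g x = d ?g w"
      using d_lip[OF xw, of ?g] d_lip[OF sym[OF xw], of ?g] by linarith
    then show ?thesis
    proof cases
      case 1
      then have "cov ?g x w" using xw by (simp add: cov_def)
      then show ?thesis using up w True by simp
    next
      case 2
      then have "cov ?g w x" using sym[OF xw] by (simp add: cov_def)
      then show ?thesis using below interval_hull[OF cov_interval] by blast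
    next
      case 3
      have "d ?g x \<noteq> 0"
      proof
        assume "d ?g x = 0"
        then have "?g = x" "?g = w" using 3 by simp_all
        then show False using xw by simp
      qed
      then obtain y where y: "cov ?g y x" "cov ?g y w" using TC[OF xw 3] by blast
      have "y \<noteq> x" using y(1) by (auto simp: cov_def)
      then have "w \<in> gated_hull2 E ?g x"
        using closedD[OF gated_closed[OF gated_hull] interval_hull[OF cov_interval[OF y(1)]] hull_right]
          cov_E'[OF y(2)] sym[OF xw] by blast
      then show ?thesis by (rule below)
    qed
  next
    case False
    then have p: "para ?g (gate E X w) x w" using gate_adjacent[OF X sym[OF xw]] by simp
    then have "cov ?g x w" by (simp add: para_def cov_def)
    then show ?thesis using up para_thick_diag[OF p x] by blast
  qed
  then show ?thesis using that by blast
qed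

interpretation delta: cgraph "delta_edge E"
proof
  show "simple_graph (delta_edge E)"
    using thick_sym by (auto simp: simple_graph_def delta_edge_iff)
  have "walk_in (delta_edge E) UNIV xs" if "walk_in E UNIV xs" for xs
    using that by (simp add: walk_in_def delta_edge_def)
  then show "connected_graph (delta_edge E)"
    using connected unfolding connected_graph_def by blast
qed

section \<open>Balls and normal paths\<close>

definition ball :: "'a \<Rightarrow> nat \<Rightarrow> 'a set" where
  "ball p k = {z. delta_dist E p z \<le> k}"

lemma thick_delta_dist:
  assumes "thick u z" shows "delta_dist E p z \<le> delta_dist E p u + 1"
proof (cases "u = z")
  case False
  then have "delta_edge E z u" using assms thick_sym delta_edge_iff by blast
  then show ?thesis by (rule delta.d_lip)
qed simp

lemma ball_Suc: "ball p (Suc k) = {z. \<exists>u\<in>ball p k. thick u z}"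
proof (intro equalityI subsetI)
  fix z assume "z \<in> ball p (Suc k)"
  then consider "delta_dist E p z \<le> k" | "delta_dist E p z = Suc k" unfolding ball_def by fastforce
  then show "z \<in> {z. \<exists>u\<in>ball p k. thick u z}"
  proof cases
    case 1
    then show ?thesis using thick_le1[of z z] by (auto simp: ball_def)
  next
    case 2
    then obtain u where "delta_edge E u z" "delta_dist E p u = k" using delta.d_step' by blast
    then show ?thesis using delta_edge_iff by (auto simp: ball_def)
  qed
next
  fix z assume "z \<in> {z. \<exists>u\<in>ball p k. thick u z}"
  then show "z \<in> ball p (Suc k)" using thick_delta_dist[of _ z p] unfolding ball_def by fastforce
qed

lemma ball_0: "ball p 0 = {p}"
  by (auto simp: ball_def)

lemma ball_gated: "gated E (ball p k)"
proof (induction k)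
  case 0
  show ?case by (auto simp: ball_0 gated_def is_gate_def mem_interval)
next
  case (Suc k)
  then show ?case unfolding ball_Suc by (rule thick_nbhd_gated)
qed

lemma delta_gate_ball: "delta_dist E p z = Suc k \<Longrightarrow> delta_gate E p z = gate E (ball p k) z"
  by (simp add: delta_gate_def ball_def)

text \<open>Both claims are carried together: the distance puts \<open>xs ! i\<close> into the ball,
  and the gate equation identifies \<open>xs ! (i - 1)\<close> when normality is invoked. If the
  gate \<open>g\<close> of the next vertex were not \<open>xs ! i\<close>, a geodesic towards
  \<open>g\<close> would start with a vertex \<open>w\<close> in both the ball and the hull, and
  \<open>boolean_gated_extend\<close> would violate normality.\<close>

lemma normal_path_gates:
  assumes xs: "normal_bg_path E xs" "hd xs = p" and "j < length xs"
  shows "delta_dist E p (xs ! j) = j \<and> (\<forall>i. j = Suc i \<longrightarrow> xs ! i = gate E (ball p i) (xs ! j))"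
  using assms(3)
proof (induction j)
  case 0
  then have "xs ! 0 = p" using xs(2) by (simp add: hd_conv_nth)
  then show ?case by simp
next
  case (Suc i)
  let ?x = "xs ! i" and ?y = "xs ! Suc i" and ?X = "ball p i"
  have IH: "delta_dist E p ?x = i" "\<And>l. i = Suc l \<Longrightarrow> xs ! l = gate E (ball p l) ?x"
    using Suc by auto
  have e: "delta_edge E ?x ?y"
    using xs(1) Suc(2) by (simp add: normal_bg_path_def walk_in_def)
  have xy: "thick ?x ?y" "?x \<noteq> ?y" using e delta_edge_iff by blast+
  have X: "gated E ?X" by (rule ball_gated)
  have xX: "?x \<in> ?X" using IH(1) by (simp add: ball_def)
  define g where "g = gate E ?X ?y"
  have gX: "g \<in> ?X" unfolding g_def by (rule gate_mem[OF X])
  have "d ?y ?x = d ?y g + d g ?x" unfolding g_def by (rule gate_d[OF X xX])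
  then have "g \<in> interval E ?y ?x" by (simp add: mem_interval)
  then have gH: "g \<in> gated_hull2 E ?x ?y" using interval_hull interval_sym by blast
  have "g = ?x"
  proof (rule ccontr)
    assume "g \<noteq> ?x"
    then obtain n where n: "d ?x g = Suc n" using d_0[of ?x g] by (metis not0_implies_Suc)
    obtain w where w: "E ?x w" "d w g = n" using d_step[OF n] by blast
    then have wI: "w \<in> interval E ?x g" using n d_1[of ?x w] by (simp add: mem_interval)
    have wX: "w \<in> ?X" using gated_convex[OF X xX gX wI] .
    have wH: "w \<in> gated_hull2 E ?x ?y" using gated_convex[OF gated_hull hull_left gH wI] .
    \<comment> \<open>For \<open>i = 0\<close> normality says nothing, but the ball is a single
      vertex.\<close>
    show False
    proof (cases i)
      case 0
      then show False using wX xX w(1) ball_0 by auto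
    next
      case (Suc l)
      let ?Y = "ball p l"
      have Y: "gated E ?Y" by (rule ball_gated)
      have tg: "thick (gate E ?Y z) z" if "z \<in> ?X" for z
        using that thick_gate[OF Y] unfolding Suc ball_Suc by blast
      obtain B where B: "boolean_gated E B" "gated_hull2 E (gate E ?Y ?x) ?x \<subseteq> B" "w \<in> B"
        using boolean_gated_extend[OF Y tg[OF xX] tg[OF wX] w(1)] by blast
      have "gate E ?Y ?x = xs ! (i - 1)" using IH(2)[OF Suc] Suc by simp
      then have "B \<inter> gated_hull2 E ?x ?y = {?x}"
        using xs(1) B(1,2) Suc \<open>Suc i < length xs\<close> unfolding normal_bg_path_def by auto
      then have "w = ?x" using B(3) wH by blast
      then show False using w(1) by simp
    qed
  qed
  moreover have "?y \<notin> ?X"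
  proof
    assume "?y \<in> ?X"
    then have "g = ?y" unfolding g_def by (rule gate_self[OF X])
    then show False using \<open>g = ?x\<close> xy by simp
  qed
  then have "delta_dist E p ?y = Suc i"
    using thick_delta_dist[OF xy(1), of p] IH(1) by (simp add: ball_def)
  ultimately show ?case by (simp add: g_def)
qed

lemma normal_path_length:
  assumes "normal_bg_path E xs" "hd xs = p" "last xs = q"
  shows "length xs = delta_dist E p q + 1" "xs ! delta_dist E p q = q"
    "\<And>i. i < delta_dist E p q \<Longrightarrow> xs ! i = delta_gate E p (xs ! Suc i)"
proof -
  have ne: "xs \<noteq> []" using assms(1) by (simp add: normal_bg_path_def walk_in_def)
  then have "last xs = xs ! (length xs - 1)" by (rule last_conv_nth)
  moreover have "length xs - 1 < length xs" using ne by simp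
  ultimately have "delta_dist E p q = length xs - 1"
    using normal_path_gates[OF assms(1,2)] assms(3) by metis
  then show len: "length xs = delta_dist E p q + 1" using ne by (cases xs) auto
  then show "xs ! delta_dist E p q = q" using \<open>last xs = xs ! (length xs - 1)\<close> assms(3) by simp
  fix i assume "i < delta_dist E p q"
  then have "Suc i < length xs" using len by simp
  then show "xs ! i = delta_gate E p (xs ! Suc i)"
    using normal_path_gates[OF assms(1,2)] delta_gate_ball by metis
qed

lemma normal_path_unique:
  assumes xs: "normal_bg_path E xs" "hd xs = p" "last xs = q"
    and ys: "normal_bg_path E ys" "hd ys = p" "last ys = q"
  shows "xs = ys"
proof (rule nth_equalityI)
  let ?k = "delta_dist E p q"
  show "length xs = length ys" using normal_path_length(1)[OF xs] normal_path_length(1)[OF ys] by simp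
  fix i assume "i < length xs"
  then have "i \<le> ?k" using normal_path_length(1)[OF xs] by simp
  then show "xs ! i = ys ! i"
  proof (induction i rule: inc_induct)
    case base
    then show ?case using normal_path_length(2)[OF xs] normal_path_length(2)[OF ys] by simp
  next
    case (step n)
    then show ?case using normal_path_length(3)[OF xs] normal_path_length(3)[OF ys] by simp
  qed
qed

lemma gate_path_exists:
  assumes "delta_dist E p q = k"
  shows "\<exists>xs. length xs = Suc k \<and> xs ! 0 = p \<and> xs ! k = q \<and>
    (\<forall>i<k. thick (xs ! i) (xs ! Suc i) \<and> xs ! i = gate E (ball p i) (xs ! Suc i)) \<and>
    (\<forall>i\<le>k. delta_dist E p (xs ! i) = i)"
  using assms
proof (induction k arbitrary: q)
  case 0
  then show ?case by (intro exI[of _ "[p]"]) simp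
next
  case (Suc k)
  let ?r = "gate E (ball p k) q"
  have "q \<in> ball p (Suc k)" using Suc(2) by (simp add: ball_def)
  then have t: "thick ?r q" using thick_gate[OF ball_gated] unfolding ball_Suc by blast
  have "?r \<in> ball p k" by (rule gate_mem[OF ball_gated])
  then have "delta_dist E p ?r \<le> k" by (simp add: ball_def)
  moreover have "Suc k \<le> delta_dist E p ?r + 1" using thick_delta_dist[OF t, of p] Suc(2) by simp
  ultimately have "delta_dist E p ?r = k" by simp
  then obtain xs where xs: "length xs = Suc k" "xs ! 0 = p" "xs ! k = ?r"
    "\<And>i. i < k \<Longrightarrow> thick (xs ! i) (xs ! Suc i) \<and> xs ! i = gate E (ball p i) (xs ! Suc i)"
    "\<And>i. i \<le> k \<Longrightarrow> delta_dist E p (xs ! i) = i"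
    using Suc(1)[of ?r] by blast
  have old: "(xs @ [q]) ! i = xs ! i" if "i \<le> k" for i using that xs(1) by (simp add: nth_append)
  have new: "(xs @ [q]) ! Suc k = q" using xs(1) by (simp add: nth_append)
  have "thick ((xs @ [q]) ! i) ((xs @ [q]) ! Suc i) \<and>
    (xs @ [q]) ! i = gate E (ball p i) ((xs @ [q]) ! Suc i)" if "i < Suc k" for i
  proof (cases "i = k")
    case True
    then show ?thesis using old[of k] new xs(3) t by simp
  next
    case False
    then have "i < k" using that by simp
    then have "(xs @ [q]) ! i = xs ! i" "(xs @ [q]) ! Suc i = xs ! Suc i" using old by simp_all
    then show ?thesis using xs(4)[OF \<open>i < k\<close>] by metis
  qed
  moreover have "delta_dist E p ((xs @ [q]) ! i) = i" if "i \<le> Suc k" for i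
  proof (cases "i = Suc k")
    case True
    then show ?thesis using new Suc(2) by simp
  next
    case False
    then show ?thesis using xs(5)[of i] old[of i] that by simp
  qed
  moreover have "length (xs @ [q]) = Suc (Suc k)" "(xs @ [q]) ! 0 = p" using xs(1,2) old[of 0] by simp_all
  ultimately show ?case using new by blast
qed

lemma normal_path_exists: "\<exists>xs. normal_bg_path E xs \<and> hd xs = p \<and> last xs = q"
proof -
  let ?k = "delta_dist E p q"
  obtain xs where xs: "length xs = Suc ?k" "xs ! 0 = p" "xs ! ?k = q"
    "\<And>i. i < ?k \<Longrightarrow> thick (xs ! i) (xs ! Suc i) \<and> xs ! i = gate E (ball p i) (xs ! Suc i)"
    "\<And>i. i \<le> ?k \<Longrightarrow> delta_dist E p (xs ! i) = i"
    using gate_path_exists[OF refl] by blast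
  have ne: "xs \<noteq> []" using xs(1) by auto
  have walk: "walk_in (delta_edge E) UNIV xs"
    unfolding walk_in_def
  proof (intro conjI allI impI ne subset_UNIV)
    fix i assume "Suc i < length xs"
    then have i: "i < ?k" using xs(1) by simp
    then have "xs ! i \<noteq> xs ! Suc i" using xs(5)[of i] xs(5)[of "Suc i"] by auto
    then show "delta_edge E (xs ! i) (xs ! Suc i)" using xs(4)[OF i] delta_edge_iff by blast
  qed
  have "normal_bg_path E xs"
    unfolding normal_bg_path_def
  proof (intro conjI allI impI walk)
    fix i B
    assume i: "1 \<le> i \<and> Suc i < length xs"
      and B: "boolean_gated E B \<and> gated_hull2 E (xs ! (i - 1)) (xs ! i) \<subseteq> B"
    let ?x = "xs ! i" and ?y = "xs ! Suc i" and ?H = "gated_hull2 E (xs ! i) (xs ! Suc i)"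
    have ik: "i < ?k" using i xs(1) by simp
    have mem: "xs ! (i - 1) \<in> B" "?x \<in> B" using B hull_left hull_right by blast+
    have gB: "gated E B" using B by (simp add: boolean_gated_def)
    have "w = ?x" if w: "w \<in> B" "w \<in> ?H" for w
    proof (rule ccontr)
      assume "w \<noteq> ?x"
      then obtain n where n: "d ?x w = Suc n" using d_0[of ?x w] by (metis not0_implies_Suc)
      \<comment> \<open>The first step towards \<open>w\<close> is a neighbour of \<open>?x\<close>
        in both sets. Membership in \<open>B\<close> puts it into the ball, so the gate property
        makes it farther from \<open>?y\<close> than \<open>?x\<close>; membership in the hull
        forbids that.\<close>
      obtain v where v: "E ?x v" "d v w = n" using d_step[OF n] by blast
      then have "v \<in> interval E ?x w" using n d_1[of ?x v] by (simp add: mem_interval)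
      then have vB: "v \<in> B" and vH: "v \<in> ?H"
        using gated_convex[OF gB mem(2) w(1)] gated_convex[OF gated_hull hull_left w(2)] by blast+
      have "thick (xs ! (i - 1)) v" using boolean_gated_thick[OF _ mem(1) vB] B by blast
      then have "delta_dist E p v \<le> delta_dist E p (xs ! (i - 1)) + 1" by (rule thick_delta_dist)
      then have "v \<in> ball p i" using xs(5)[of "i - 1"] i ik by (simp add: ball_def)
      then have "d ?y v = d ?y ?x + d ?x v" using gate_d[OF ball_gated, of v p i ?y] xs(4)[OF ik] by simp
      moreover have "d ?x v = 1" using v(1) d_1 by blast
      moreover have "d ?y v \<le> d ?y ?x" using hull_neighbour[OF _ vH v(1)] xs(4)[OF ik] by blast
      ultimately show False by simp
    qed
    then show "B \<inter> ?H = {?x}" using mem(2) hull_left by blast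
  qed
  moreover have "hd xs = p" "last xs = q" using xs ne by (simp_all add: hd_conv_nth last_conv_nth)
  ultimately show ?thesis by blast
qed

end

theorem theorem6p24:
  fixes E :: "'a \<Rightarrow> 'a \<Rightarrow> bool" and p q :: 'a
  assumes "swm_graph E"
  shows "(\<exists>!xs. normal_bg_path E xs \<and> hd xs = p \<and> last xs = q) \<and>
         (\<forall>xs. normal_bg_path E xs \<and> hd xs = p \<and> last xs = q \<longrightarrow>
            length xs = delta_dist E p q + 1 \<and>
            xs ! delta_dist E p q = q \<and>
            (\<forall>i < delta_dist E p q. xs ! i = delta_gate E p (xs ! Suc i)))"
proof -
  interpret swm E using assms by unfold_locales
  show ?thesis
  proof (intro conjI allI impI)
    show "\<exists>!xs. normal_bg_path E xs \<and> hd xs = p \<and> last xs = q"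
      using normal_path_exists normal_path_unique by blast
  next
    fix xs assume "normal_bg_path E xs \<and> hd xs = p \<and> last xs = q"
    then have xs: "normal_bg_path E xs" "hd xs = p" "last xs = q" by auto
    show "length xs = delta_dist E p q + 1" "xs ! delta_dist E p q = q"
      using normal_path_length(1,2)[OF xs] .
    show "xs ! i = delta_gate E p (xs ! Suc i)" if "i < delta_dist E p q" for i
      using normal_path_length(3)[OF xs that] .
  qed
qed

end
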